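(* Let $\mathbb{F}_2=\langle a,b\rangle$ be the free group on two generators. For any $r\in[0,1]$ there exists a unitary $u\in L(\mathbb{F}_2)$ such that $\mathrm{d}_{\mathrm{MT}}(L(\langle a\rangle),uL(\langle a\rangle)u^* )=r$.
   Context: For a countable discrete group $G$, $L(G)=\{\lambda_g:g\in G\}''\subseteq B(\ell^2(G))$ is the group von Neumann algebra, with canonical trace $\tau(x)=\langle x\delta_e,\delta_e\rangle$; for a subgroup $H\le G$, $L(H)$ is viewed as the subalgebra $\{\lambda_h:h\in H\}''$ of $L(G)$. Mashood–Taylor distance: for von Neumann subalgebras $P,Q$ of $(M,\tau)$, $\mathrm{d}_{\mathrm{MT}}(P,Q)$ is the Hausdorff distance, with respect to $\|x\|_\tau=\tau(x^*x)^{1/2}$, between the operator-norm closed unit balls of $P$ and $Q$. Here $M=L(\mathbb{F}_2)$. *)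

theory Defs
  imports "HOL-Analysis.Analysis" "HOL-Algebra.Generated_Groups"
begin

section \<open>Free groups\<close>

text \<open>The letter \<open>(x, True)\<close> stands for the generator \<open>x\<close> and \<open>(x, False)\<close> for its formal inverse.
  The free group consists of all words modulo insertion and deletion of pairs of adjacent,
  mutually inverse letters.\<close>

inductive cancels :: "('x \<times> bool) list \<Rightarrow> ('x \<times> bool) list \<Rightarrow> bool" where
  "cancels (us @ [(x, s), (x, \<not> s)] @ vs) (us @ vs)"

quotient_type 'x free_group = "('x \<times> bool) list" / "equivclp cancels"
  by (rule equivp_evquivclp)

lemma cancels_append_left: "cancels v v' \<Longrightarrow> cancels (u @ v) (u @ v')"
  by (metis append.assoc cancels.simps)

lemma cancels_append_right: "cancels u u' \<Longrightarrow> cancels (u @ v) (u' @ v)"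
  by (smt (verit) append.assoc cancels.simps)

lemma equivclp_cancels_append:
  assumes "equivclp cancels u u'" "equivclp cancels v v'"
  shows "equivclp cancels (u @ v) (u' @ v')"
proof -
  have "equivclp cancels (u @ v) (u' @ v)"
    using assms(1)
    by (induction rule: equivclp_induct)
      (auto intro: equivclp_into_equivclp cancels_append_right)
  moreover have "equivclp cancels (u' @ v) (u' @ v')"
    using assms(2)
    by (induction rule: equivclp_induct)
      (auto intro: equivclp_into_equivclp cancels_append_left)
  ultimately show ?thesis
    by (rule equivclp_trans)
qed

lift_definition fg_mult :: "'x free_group \<Rightarrow> 'x free_group \<Rightarrow> 'x free_group" is append
  by (rule equivclp_cancels_append)

lift_definition fg_one :: "'x free_group" is "[]" .

lift_definition fg_gen :: "'x \<Rightarrow> 'x free_group" is "\<lambda>x. [(x, True)]" .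

definition FreeGroup :: "'x free_group monoid" where
  "FreeGroup = \<lparr>carrier = UNIV, mult = fg_mult, one = fg_one\<rparr>"

lemma carrier_FreeGroup [simp]: "carrier FreeGroup = UNIV"
  by (simp add: FreeGroup_def)

definition inv_word :: "('x \<times> bool) list \<Rightarrow> ('x \<times> bool) list" where
  "inv_word w = rev (map (\<lambda>(x, s). (x, \<not> s)) w)"

lemma inv_word_append: "equivclp cancels (inv_word w @ w) []"
proof (induction w)
  case Nil
  then show ?case by (simp add: inv_word_def)
next
  case (Cons l w)
  obtain x s where l: "l = (x, s)" by (cases l)
  have "cancels (inv_word w @ [(x, \<not> s), (x, \<not> \<not> s)] @ w) (inv_word w @ w)"
    by (rule cancels.intros)
  then have "cancels (inv_word (l # w) @ l # w) (inv_word w @ w)"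
    by (simp add: inv_word_def l)
  with Cons.IH show ?case
    by (meson equivclp_trans r_into_equivclp)
qed

lemma group_FreeGroup: "group FreeGroup"
proof (rule groupI)
  fix g :: "'x free_group"
  show "\<exists>h\<in>carrier FreeGroup. h \<otimes>\<^bsub>FreeGroup\<^esub> g = \<one>\<^bsub>FreeGroup\<^esub>"
    unfolding FreeGroup_def by simp (transfer, use inv_word_append in blast)
qed (simp_all add: FreeGroup_def, (transfer, simp)+)

text \<open>The free group of rank two; \<open>a\<close> and \<open>b\<close> of the usual notation are
  \<open>fg_gen gen_a\<close> and \<open>fg_gen gen_b\<close>.\<close>

datatype gen2 = gen_a | gen_b

abbreviation F2 :: "gen2 free_group monoid" where
  "F2 \<equiv> FreeGroup"


section \<open>The Hilbert space of square-summable functions\<close>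

typedef 'g ell2 = "{f :: 'g \<Rightarrow> complex. (\<lambda>g. (cmod (f g))\<^sup>2) summable_on UNIV}"
  morphisms ell2_fun Abs_ell2
  by (rule exI[of _ "\<lambda>_. 0"]) simp

setup_lifting type_definition_ell2

lemma sq_summable_inner:
  fixes f h :: "'g \<Rightarrow> complex"
  assumes "(\<lambda>g. (cmod (f g))\<^sup>2) summable_on UNIV" "(\<lambda>g. (cmod (h g))\<^sup>2) summable_on UNIV"
  shows "(\<lambda>g. f g \<bullet> h g) summable_on UNIV"
proof (rule Infinite_Sum.abs_summable_summable, rule Infinite_Sum.abs_summable_on_comparison_test')
  show "(\<lambda>g. (cmod (f g))\<^sup>2 + (cmod (h g))\<^sup>2) summable_on UNIV"
    using assms by (rule summable_on_add)
  fix g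
  have "norm (f g \<bullet> h g) \<le> cmod (f g) * cmod (h g)"
    using Cauchy_Schwarz_ineq2 by auto
  also have "\<dots> \<le> (cmod (f g))\<^sup>2 + (cmod (h g))\<^sup>2"
    using sum_squares_bound[of "cmod (f g)" "cmod (h g)"]
      mult_nonneg_nonneg[OF norm_ge_zero[of "f g"] norm_ge_zero[of "h g"]]
    by linarith
  finally show "norm (f g \<bullet> h g) \<le> (cmod (f g))\<^sup>2 + (cmod (h g))\<^sup>2" .
qed

lemma sq_summable_add:
  fixes f h :: "'g \<Rightarrow> complex"
  assumes "(\<lambda>g. (cmod (f g))\<^sup>2) summable_on UNIV" "(\<lambda>g. (cmod (h g))\<^sup>2) summable_on UNIV"
  shows "(\<lambda>g. (cmod (f g + h g))\<^sup>2) summable_on UNIV"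
proof -
  have "(\<lambda>g. (cmod (f g))\<^sup>2 + (cmod (h g))\<^sup>2 + 2 * (f g \<bullet> h g)) summable_on UNIV"
    by (intro summable_on_add summable_on_cmult_right assms sq_summable_inner)
  also have "(\<lambda>g. (cmod (f g))\<^sup>2 + (cmod (h g))\<^sup>2 + 2 * (f g \<bullet> h g)) = (\<lambda>g. (cmod (f g + h g))\<^sup>2)"
    by (rule ext, simp only: power2_norm_eq_inner inner_add_left inner_add_right)
      (simp add: inner_commute)
  finally show ?thesis .
qed

lemma sq_summable_scale:
  fixes f :: "'g \<Rightarrow> complex"
  assumes "(\<lambda>g. (cmod (f g))\<^sup>2) summable_on UNIV"
  shows "(\<lambda>g. (cmod (c * f g))\<^sup>2) summable_on UNIV"
  using summable_on_cmult_right[OF assms, of "(cmod c)\<^sup>2"]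
  by (simp add: norm_mult power_mult_distrib)

instantiation ell2 :: (type) real_vector
begin

lift_definition zero_ell2 :: "'a ell2" is "\<lambda>_. 0" by simp

lift_definition plus_ell2 :: "'a ell2 \<Rightarrow> 'a ell2 \<Rightarrow> 'a ell2" is "\<lambda>f h g. f g + h g"
  by (rule sq_summable_add)

lift_definition uminus_ell2 :: "'a ell2 \<Rightarrow> 'a ell2" is "\<lambda>f g. - f g" by simp

lift_definition minus_ell2 :: "'a ell2 \<Rightarrow> 'a ell2 \<Rightarrow> 'a ell2" is "\<lambda>f h g. f g - h g"
  using sq_summable_add[where h = "\<lambda>g. - h g" for h] by simp

lift_definition scaleR_ell2 :: "real \<Rightarrow> 'a ell2 \<Rightarrow> 'a ell2" is "\<lambda>r f g. r *\<^sub>R f g"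
  by (simp add: scaleR_conv_of_real sq_summable_scale)

instance
proof
  fix x y z :: "'a ell2" and r s :: real
  show "x + y + z = x + (y + z)" by transfer (simp add: add.assoc)
  show "x + y = y + x" by transfer (simp add: add.commute)
  show "0 + x = x" by transfer simp
  show "- x + x = 0" by transfer simp
  show "x - y = x + - y" by transfer simp
  show "r *\<^sub>R (x + y) = r *\<^sub>R x + r *\<^sub>R y" by transfer (simp add: scaleR_add_right)
  show "(r + s) *\<^sub>R x = r *\<^sub>R x + s *\<^sub>R x" by transfer (simp add: scaleR_add_left)
  show "r *\<^sub>R s *\<^sub>R x = (r * s) *\<^sub>R x" by transfer simp
  show "1 *\<^sub>R x = x" by transfer simp
qed

end

text \<open>The real inner product below is the real part of the complex inner product \<open>cinner\<close>
  defined later, so it induces the usual norm.\<close>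

instantiation ell2 :: (type) real_inner
begin

lift_definition inner_ell2 :: "'a ell2 \<Rightarrow> 'a ell2 \<Rightarrow> real" is
  "\<lambda>f h. \<Sum>\<^sub>\<infinity>g. f g \<bullet> h g" .

definition norm_ell2 :: "'a ell2 \<Rightarrow> real" where "norm_ell2 x = sqrt (x \<bullet> x)"

definition sgn_ell2 :: "'a ell2 \<Rightarrow> 'a ell2" where "sgn_ell2 x = x /\<^sub>R norm x"

definition dist_ell2 :: "'a ell2 \<Rightarrow> 'a ell2 \<Rightarrow> real" where "dist_ell2 x y = norm (x - y)"

definition uniformity_ell2 :: "('a ell2 \<times> 'a ell2) filter" where
  "uniformity_ell2 = (INF e\<in>{0<..}. principal {(x, y). dist x y < e})"

definition open_ell2 :: "'a ell2 set \<Rightarrow> bool" where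
  "open_ell2 U \<longleftrightarrow> (\<forall>x\<in>U. eventually (\<lambda>(x', y). x' = x \<longrightarrow> y \<in> U) uniformity)"

instance
proof
  fix x y z :: "'a ell2" and r s :: real
  show "x \<bullet> y = y \<bullet> x" by transfer (simp add: inner_commute)
  show "(x + y) \<bullet> z = x \<bullet> z + y \<bullet> z"
    by transfer (simp add: inner_add_left infsum_add sq_summable_inner)
  show "r *\<^sub>R x \<bullet> y = r * (x \<bullet> y)" by transfer (simp add: infsum_cmult_right')
  show "0 \<le> x \<bullet> x" by transfer (simp add: infsum_nonneg)
  show "(x \<bullet> x = 0) = (x = 0)"
  proof transfer
    fix f :: "'a \<Rightarrow> complex"
    assume f: "(\<lambda>g. (cmod (f g))\<^sup>2) summable_on UNIV"
    show "((\<Sum>\<^sub>\<infinity>g. f g \<bullet> f g) = 0) = (f = (\<lambda>_. 0))"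
    proof
      assume z: "(\<Sum>\<^sub>\<infinity>g. f g \<bullet> f g) = 0"
      have "f g \<bullet> f g = 0" for g
        by (rule nonneg_infsum_le_0D[where A = UNIV])
          (use z in \<open>auto intro: sq_summable_inner f\<close>)
      then show "f = (\<lambda>_. 0)" by auto
    qed simp
  qed
qed (fact sgn_ell2_def dist_ell2_def uniformity_ell2_def open_ell2_def norm_ell2_def)+

end

lift_definition cscale :: "complex \<Rightarrow> 'g ell2 \<Rightarrow> 'g ell2" is "\<lambda>c f g. c * f g"
  by (rule sq_summable_scale)

lift_definition cinner :: "'g ell2 \<Rightarrow> 'g ell2 \<Rightarrow> complex" is
  "\<lambda>f h. \<Sum>\<^sub>\<infinity>g. f g * cnj (h g)" .

lift_definition delta :: "'g \<Rightarrow> 'g ell2" is "\<lambda>g h. if h = g then 1 else 0"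
proof -
  fix g :: 'g
  have "(\<lambda>h. (cmod (if h = g then 1 else 0))\<^sup>2) summable_on {g}"
    by simp
  then show "(\<lambda>h. (cmod (if h = g then 1 else 0))\<^sup>2) summable_on UNIV"
    by (rule summable_on_cong_neutral[THEN iffD1, rotated -1]) auto
qed

lemma cmod_sq_summable: "(\<lambda>g. (cmod (ell2_fun x g))\<^sup>2) summable_on UNIV"
  using ell2_fun by simp

lemma norm_ell2_eq: "norm x = sqrt (\<Sum>\<^sub>\<infinity>g. (cmod (ell2_fun x g))\<^sup>2)"
  by (simp add: norm_ell2_def inner_ell2.rep_eq power2_norm_eq_inner)

lemma cinner_summable: "(\<lambda>g. ell2_fun x g * cnj (ell2_fun y g)) summable_on UNIV"
proof (rule Infinite_Sum.abs_summable_summable, rule Infinite_Sum.abs_summable_on_comparison_test')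
  show "(\<lambda>g. (cmod (ell2_fun x g))\<^sup>2 + (cmod (ell2_fun y g))\<^sup>2) summable_on UNIV"
    by (intro summable_on_add cmod_sq_summable)
  fix g
  show "norm (ell2_fun x g * cnj (ell2_fun y g)) \<le> (cmod (ell2_fun x g))\<^sup>2 + (cmod (ell2_fun y g))\<^sup>2"
    using sum_squares_bound[of "cmod (ell2_fun x g)" "cmod (ell2_fun y g)"]
      mult_nonneg_nonneg[OF norm_ge_zero[of "ell2_fun x g"] norm_ge_zero[of "ell2_fun y g"]]
    unfolding norm_mult complex_mod_cnj by linarith
qed

lemma Re_cinner: "Re (cinner x y) = x \<bullet> y"
  by (simp add: cinner.rep_eq inner_ell2.rep_eq infsum_Re[OF cinner_summable, symmetric]
      inner_complex_def)

lemma cinner_delta: "cinner x (delta g) = ell2_fun x g"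
proof -
  have "cinner x (delta g) = (\<Sum>\<^sub>\<infinity>h\<in>{g}. ell2_fun x h)"
    unfolding cinner.rep_eq delta.rep_eq by (rule infsum_cong_neutral) auto
  then show ?thesis by simp
qed


section \<open>Bounded operators\<close>

text \<open>The norm on \<open>'g ell2 \<Rightarrow>\<^sub>L 'g ell2\<close> is the operator norm, but elements of this type are only
  real-linear.\<close>

definition bounded_ops :: "('g ell2 \<Rightarrow>\<^sub>L 'g ell2) set" where
  "bounded_ops = {T. \<forall>c x. blinfun_apply T (cscale c x) = cscale c (blinfun_apply T x)}"

definition adj :: "('g ell2 \<Rightarrow>\<^sub>L 'g ell2) \<Rightarrow> ('g ell2 \<Rightarrow>\<^sub>L 'g ell2)" where
  "adj T = (THE S. S \<in> bounded_ops \<and>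
     (\<forall>x y. cinner (blinfun_apply T x) y = cinner x (blinfun_apply S y)))"

lemma adj_eqI:
  assumes "S \<in> bounded_ops"
    and "\<And>x y. cinner (blinfun_apply T x) y = cinner x (blinfun_apply S y)"
  shows "adj T = S"
  unfolding adj_def
proof (rule the_equality)
  fix R assume R: "R \<in> bounded_ops \<and>
    (\<forall>x y. cinner (blinfun_apply T x) y = cinner x (blinfun_apply R y))"
  show "R = S"
  proof (rule blinfun_eqI)
    fix y
    have "x \<bullet> blinfun_apply R y = x \<bullet> blinfun_apply S y" for x
      using R assms(2) by (metis Re_cinner)
    then show "blinfun_apply R y = blinfun_apply S y"
      by (metis vector_eq_ldot)
  qed
qed (use assms in auto)

definition commutant :: "('g ell2 \<Rightarrow>\<^sub>L 'g ell2) set \<Rightarrow> ('g ell2 \<Rightarrow>\<^sub>L 'g ell2) set" where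
  "commutant S = {T \<in> bounded_ops. \<forall>s\<in>S. T o\<^sub>L s = s o\<^sub>L T}"

definition unitary_op :: "('g ell2 \<Rightarrow>\<^sub>L 'g ell2) \<Rightarrow> bool" where
  "unitary_op u \<longleftrightarrow> u \<in> bounded_ops \<and> u o\<^sub>L adj u = id_blinfun \<and> adj u o\<^sub>L u = id_blinfun"


section \<open>Group von Neumann algebras\<close>

text \<open>Throughout, \<open>G\<close> is a group whose carrier is the whole type \<open>'g\<close>, so that \<open>'g ell2\<close> is
  \<open>\<ell>\<^sup>2(G)\<close>. The translation by \<open>g\<close> maps \<open>\<delta>\<^sub>h\<close> to \<open>\<delta>\<^sub>g\<^sub>h\<close>.\<close>

definition left_reg :: "('g, 'm) monoid_scheme \<Rightarrow> 'g \<Rightarrow> ('g ell2 \<Rightarrow>\<^sub>L 'g ell2)" where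
  "left_reg G g = Blinfun (\<lambda>x. Abs_ell2 (\<lambda>h. ell2_fun x (m_inv G g \<otimes>\<^bsub>G\<^esub> h)))"

definition group_vN :: "('g, 'm) monoid_scheme \<Rightarrow> 'g set \<Rightarrow> ('g ell2 \<Rightarrow>\<^sub>L 'g ell2) set" where
  "group_vN G H = commutant (commutant (left_reg G ` H))"

definition tr :: "('g, 'm) monoid_scheme \<Rightarrow> ('g ell2 \<Rightarrow>\<^sub>L 'g ell2) \<Rightarrow> complex" where
  "tr G x = cinner (blinfun_apply x (delta \<one>\<^bsub>G\<^esub>)) (delta \<one>\<^bsub>G\<^esub>)"

definition tr_norm :: "('g, 'm) monoid_scheme \<Rightarrow> ('g ell2 \<Rightarrow>\<^sub>L 'g ell2) \<Rightarrow> real" where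
  "tr_norm G x = sqrt (Re (tr G (adj x o\<^sub>L x)))"

definition unit_ball :: "'v::real_normed_vector set \<Rightarrow> 'v set" where
  "unit_ball P = {x \<in> P. norm x \<le> 1}"

text \<open>Real-valued suprema and infima: the sets involved must be nonempty and at bounded distance,
  as is the case for unit balls of von Neumann algebras with respect to the trace norm.\<close>

definition hausdorff_distance :: "('v \<Rightarrow> 'v \<Rightarrow> real) \<Rightarrow> 'v set \<Rightarrow> 'v set \<Rightarrow> real" where
  "hausdorff_distance d A B =
     max (SUP x\<in>A. INF y\<in>B. d x y) (SUP y\<in>B. INF x\<in>A. d x y)"

definition d_MT ::
  "('g, 'm) monoid_scheme \<Rightarrow> ('g ell2 \<Rightarrow>\<^sub>L 'g ell2) set \<Rightarrow> ('g ell2 \<Rightarrow>\<^sub>L 'g ell2) set \<Rightarrow> real" where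
  "d_MT G P Q = hausdorff_distance (\<lambda>x y. tr_norm G (x - y)) (unit_ball P) (unit_ball Q)"

definition conj_by ::
  "('g ell2 \<Rightarrow>\<^sub>L 'g ell2) \<Rightarrow> ('g ell2 \<Rightarrow>\<^sub>L 'g ell2) set \<Rightarrow> ('g ell2 \<Rightarrow>\<^sub>L 'g ell2) set" where
  "conj_by u P = (\<lambda>x. u o\<^sub>L x o\<^sub>L adj u) ` P"

context
  fixes G :: "('g, 'm) monoid_scheme"
  assumes G: "group G" and carrier_G: "carrier G = UNIV"
begin

lemma bij_left_mult: "bij (\<lambda>h. g \<otimes>\<^bsub>G\<^esub> h)"
proof (rule bij_betw_byWitness[where f' = "\<lambda>h. m_inv G g \<otimes>\<^bsub>G\<^esub> h"])
qed (use G carrier_G in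
    \<open>auto simp: group.inv_solve_left group.inv_solve_left' monoid.m_assoc[symmetric]
        group.is_monoid group.l_inv group.r_inv monoid.l_one\<close>)

lemma left_reg_sq_summable:
  "(\<lambda>h. (cmod (ell2_fun x (g \<otimes>\<^bsub>G\<^esub> h)))\<^sup>2) summable_on UNIV"
  using summable_on_reindex_bij_betw[OF bij_left_mult, of "\<lambda>k. (cmod (ell2_fun x k))\<^sup>2"]
  by (simp add: cmod_sq_summable)

lemma ell2_fun_left_reg:
  "ell2_fun (blinfun_apply (left_reg G g) x) h = ell2_fun x (m_inv G g \<otimes>\<^bsub>G\<^esub> h)"
proof -
  define L where "L = (\<lambda>x. Abs_ell2 (\<lambda>h. ell2_fun x (m_inv G g \<otimes>\<^bsub>G\<^esub> h)))"
  have L: "ell2_fun (L x) = (\<lambda>h. ell2_fun x (m_inv G g \<otimes>\<^bsub>G\<^esub> h))" for x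
    unfolding L_def by (rule Abs_ell2_inverse) (simp add: left_reg_sq_summable)
  have "norm (L x) = norm x" for x
    unfolding norm_ell2_eq L
    using infsum_reindex_bij_betw[OF bij_left_mult, of "\<lambda>k. (cmod (ell2_fun x k))\<^sup>2"] by simp
  then have "bounded_linear L"
    by (intro bounded_linear_intro[where K = 1])
      (auto simp: ell2_fun_inject[symmetric] L plus_ell2.rep_eq scaleR_ell2.rep_eq)
  then have "blinfun_apply (left_reg G g) x = L x"
    by (simp add: left_reg_def L_def bounded_linear_Blinfun_apply)
  then show ?thesis by (simp add: L)
qed

lemma left_reg_bounded_ops: "left_reg G g \<in> bounded_ops"
  by (auto simp: bounded_ops_def ell2_fun_inject[symmetric] cscale.rep_eq ell2_fun_left_reg)

end

end

theory Submission
  imports Defs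
begin

text \<open>Write \<open>A = L(\<langle>a\<rangle>)\<close>. The idea is to conjugate by unitaries \<open>u \<in> L(\<langle>b\<rangle>)\<close>, because freeness of
  \<open>\<langle>a\<rangle>\<close> and \<open>\<langle>b\<rangle>\<close> makes the distance depend on the trace of \<open>u\<close> alone. Decompose \<open>u = \<tau>(u) + u\<^sub>0\<close>
  and \<open>x = \<tau>(x) + x\<^sub>0\<close> with \<open>x \<in> A\<close> and traceless parts \<open>u\<^sub>0\<close>, \<open>x\<^sub>0\<close>. In the expansion of \<open>u x\<^sub>0 u\<^sup>*\<close> every
  term with a factor \<open>u\<^sub>0\<close> or \<open>u\<^sub>0\<^sup>*\<close> is orthogonal to \<open>A\<close>, so the conditional expectation of
  \<open>u x u\<^sup>*\<close> onto \<open>A\<close> is \<open>\<tau>(x) + t x\<^sub>0 = t x + (1 - t) \<tau>(x)\<close> with \<open>t = \<bar>\<tau>(u)\<bar>\<^sup>2\<close>. This element lies in the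
  unit ball of \<open>A\<close> whenever \<open>x\<close> does, hence is the nearest point of that ball to \<open>u x u\<^sup>*\<close>, and the
  squared distance is \<open>(1 - t\<^sup>2) \<parallel>x\<^sub>0\<parallel>\<^sup>2\<close>. The supremum over the unit ball is attained at
  \<open>x = \<lambda>\<^sub>a\<close>, and the situation is symmetric in the two balls, so the Mashood--Taylor distance is
  \<open>sqrt (1 - t\<^sup>2)\<close>. This is lemma \<open>d_MT_conj_by\<close>.

  It remains to find unitaries in \<open>L(\<langle>b\<rangle>)\<close> with prescribed trace in absolute value. The Blaschke
  factor \<open>(z - \<alpha>) / (1 - \<alpha> z)\<close> has modulus one on the circle and constant coefficient \<open>- \<alpha>\<close>. Its
  power series converges absolutely on the unit circle, so it can be summed in operator norm at
  \<open>z = \<lambda>\<^sub>b\<close>. This gives \<open>t = \<alpha>\<^sup>2\<close> for every \<open>0 \<le> \<alpha> < 1\<close> (\<open>d_MT_conj_by_blaschke\<close>), and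
  \<open>r = sqrt (1 - \<alpha>\<^sup>4)\<close> covers all of \<open>(0, 1]\<close>, while \<open>r = 0\<close> is obtained from \<open>u = 1\<close>. Freeness enters through
  \<open>conj_in_generate_a\<close>: a non-trivial element \<open>b\<^sup>-\<^sup>i a\<^sup>m b\<^sup>j\<close> with \<open>i, j \<ge> 0\<close> is a power of \<open>a\<close> only if
  \<open>i = j = 0\<close>.

  All computations with \<open>L(G)\<close> take place in \<open>\<ell>\<^sup>2(G)\<close>: the trace norm of \<open>x\<close> is the norm of the vector
  \<open>x \<delta>\<^sub>e\<close> (\<open>tr_norm_eq\<close>), vectors of elements of \<open>L(H)\<close> are supported on \<open>H\<close> (\<open>group_vN_support\<close>), and
  conjugation by \<open>u\<close> acts on vectors as \<open>u\<close> followed by right multiplication by \<open>u\<^sup>*\<close>.\<close>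

section \<open>The Hilbert space of square-summable functions\<close>

lemma ell2_eqI: "(\<And>g. ell2_fun x g = ell2_fun y g) \<Longrightarrow> x = y"
  by (simp add: ell2_fun_inject[symmetric] fun_eq_iff)

lemma norm_ell2_power2: "(norm x)\<^sup>2 = (\<Sum>\<^sub>\<infinity>g. (cmod (ell2_fun x g))\<^sup>2)"
  unfolding norm_ell2_eq by (simp add: infsum_nonneg)

lemma sum_cmod_sq_le_norm:
  assumes "finite F"
  shows "(\<Sum>g\<in>F. (cmod (ell2_fun x g))\<^sup>2) \<le> (norm x)\<^sup>2"
  unfolding norm_ell2_power2
  using finite_sum_le_infsum[OF cmod_sq_summable assms, of x] by simp

lemma cmod_ell2_fun_le_norm: "cmod (ell2_fun x g) \<le> norm x"
  using sum_cmod_sq_le_norm[of "{g}" x] by (simp add: power2_le_iff_abs_le)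

lemma bounded_linear_ell2_fun: "bounded_linear (\<lambda>x. ell2_fun x g)"
  by (rule bounded_linear_intro[where K = 1])
    (simp_all add: plus_ell2.rep_eq scaleR_ell2.rep_eq cmod_ell2_fun_le_norm)

lemma ell2_of_finite_bounds:
  assumes "\<And>F. finite F \<Longrightarrow> (\<Sum>g\<in>F. (cmod (f g))\<^sup>2) \<le> K\<^sup>2" and "K \<ge> 0"
  obtains x where "ell2_fun x = f" "norm x \<le> K"
proof -
  have f: "(\<lambda>g. (cmod (f g))\<^sup>2) summable_on UNIV"
    using assms(1) by (intro nonneg_bdd_above_summable_on) (auto intro!: bdd_aboveI[of _ "K\<^sup>2"])
  then have x: "ell2_fun (Abs_ell2 f) = f"
    by (simp add: Abs_ell2_inverse)
  have "(norm (Abs_ell2 f))\<^sup>2 \<le> K\<^sup>2"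
    unfolding norm_ell2_power2 x by (rule infsum_le_finite_sums[OF f assms(1)])
  then have "norm (Abs_ell2 f) \<le> K"
    using \<open>K \<ge> 0\<close> by (rule power2_le_imp_le)
  with x show ?thesis by (rule that)
qed

text \<open>The pointwise limit of a Cauchy sequence is a limit in norm, because every finite partial sum
  of the squared distance passes to the limit.\<close>

instance ell2 :: (type) banach
proof
  fix X :: "nat \<Rightarrow> 'a ell2"
  assume X: "Cauchy X"
  have "Cauchy (\<lambda>n. ell2_fun (X n) g)" for g
    using bounded_linear.Cauchy[OF bounded_linear_ell2_fun X] .
  then obtain f where f: "(\<lambda>n. ell2_fun (X n) g) \<longlonglongrightarrow> f g" for g
    unfolding Cauchy_convergent_iff convergent_def by metis
  have close: "\<exists>N. \<forall>n\<ge>N. \<exists>y. ell2_fun y = (\<lambda>g. ell2_fun (X n) g - f g) \<and> norm y \<le> e"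
    if "e > 0" for e
  proof -
    obtain N where N: "norm (X m - X n) < e" if "m \<ge> N" "n \<ge> N" for m n
      using X \<open>e > 0\<close> unfolding Cauchy_iff by blast
    have "\<exists>y. ell2_fun y = (\<lambda>g. ell2_fun (X n) g - f g) \<and> norm y \<le> e" if "n \<ge> N" for n
    proof (rule ell2_of_finite_bounds)
      fix F :: "'a set" assume F: "finite F"
      have "(\<lambda>m. \<Sum>g\<in>F. (cmod (ell2_fun (X n) g - ell2_fun (X m) g))\<^sup>2)
          \<longlonglongrightarrow> (\<Sum>g\<in>F. (cmod (ell2_fun (X n) g - f g))\<^sup>2)"
        by (intro tendsto_intros f)
      moreover have "(\<Sum>g\<in>F. (cmod (ell2_fun (X n) g - ell2_fun (X m) g))\<^sup>2) \<le> e\<^sup>2"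
        if "m \<ge> N" for m
      proof -
        have "(\<Sum>g\<in>F. (cmod (ell2_fun (X n) g - ell2_fun (X m) g))\<^sup>2) \<le> (norm (X n - X m))\<^sup>2"
          using sum_cmod_sq_le_norm[OF F, of "X n - X m"] by (simp add: minus_ell2.rep_eq)
        also have "\<dots> \<le> e\<^sup>2"
          using N[OF \<open>n \<ge> N\<close> that] by (intro power_mono) auto
        finally show ?thesis .
      qed
      ultimately show "(\<Sum>g\<in>F. (cmod (ell2_fun (X n) g - f g))\<^sup>2) \<le> e\<^sup>2"
        by (intro LIMSEQ_le_const2) auto
    qed (use \<open>e > 0\<close> in auto)
    then show ?thesis by blast
  qed
  obtain n y where y: "ell2_fun y = (\<lambda>g. ell2_fun (X n) g - f g)"
    using close[OF zero_less_one] by blast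
  have "X \<longlonglongrightarrow> X n - y"
    unfolding lim_sequentially
  proof (intro allI impI)
    fix e :: real assume "e > 0"
    then obtain N where N: "\<exists>z. ell2_fun z = (\<lambda>g. ell2_fun (X m) g - f g) \<and> norm z \<le> e / 2"
      if "m \<ge> N" for m
      using close[of "e / 2"] by auto
    have "dist (X m) (X n - y) < e" if m: "m \<ge> N" for m
    proof -
      obtain z where z: "ell2_fun z = (\<lambda>g. ell2_fun (X m) g - f g)" "norm z \<le> e / 2"
        using N[OF m] by blast
      then have "X m - (X n - y) = z"
        by (intro ell2_eqI) (simp add: minus_ell2.rep_eq y)
      with z \<open>e > 0\<close> show ?thesis by (simp add: dist_norm)
    qed
    then show "\<exists>N. \<forall>m\<ge>N. dist (X m) (X n - y) < e" by blast
  qed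
  then show "convergent X" by (auto simp: convergent_def)
qed

lemma cinner_add_left: "cinner (x + y) z = cinner x z + cinner y z"
  unfolding cinner.rep_eq plus_ell2.rep_eq distrib_right
  by (intro infsum_add cinner_summable)

lemma cinner_cscale_left: "cinner (cscale c x) y = c * cinner x y"
  unfolding cinner.rep_eq cscale.rep_eq mult.assoc by (rule infsum_cmult_right')

lemma cinner_commute: "cinner x y = cnj (cinner y x)"
  unfolding cinner.rep_eq infsum_cnj[symmetric] by (simp add: mult.commute)

lemma cinner_scaleR_left: "cinner (r *\<^sub>R x) y = r *\<^sub>R cinner x y"
proof -
  have "r *\<^sub>R x = cscale (of_real r) x"
    by (intro ell2_eqI) (simp add: scaleR_ell2.rep_eq cscale.rep_eq scaleR_conv_of_real)
  then show ?thesis by (simp add: cinner_cscale_left scaleR_conv_of_real)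
qed

lemma cinner_eq_Complex_inner: "cinner x y = Complex (x \<bullet> y) (x \<bullet> cscale \<i> y)"
proof -
  have "cinner x (cscale \<i> y) = - \<i> * cinner x y"
    by (metis cinner_commute cinner_cscale_left complex_cnj_i complex_cnj_mult)
  then have "Im (cinner x y) = Re (cinner x (cscale \<i> y))"
    by simp
  then show ?thesis by (simp add: complex_eq_iff Re_cinner)
qed

lemma norm_cscale: "norm (cscale c x) = cmod c * norm x"
  unfolding norm_ell2_eq cscale.rep_eq norm_mult power_mult_distrib
  by (simp add: infsum_cmult_right' real_sqrt_mult)

lemma norm_delta: "norm (delta g) = 1"
proof -
  have "(\<Sum>\<^sub>\<infinity>h. (cmod (ell2_fun (delta g) h))\<^sup>2) = (\<Sum>\<^sub>\<infinity>h\<in>{g}. 1)"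
    unfolding delta.rep_eq by (rule infsum_cong_neutral) auto
  then show ?thesis by (simp add: norm_ell2_eq)
qed

lemma inner_delta: "x \<bullet> cscale c (delta g) = ell2_fun x g \<bullet> c"
proof -
  have "x \<bullet> cscale c (delta g) = (\<Sum>\<^sub>\<infinity>h\<in>{g}. ell2_fun x h \<bullet> c)"
    unfolding inner_ell2.rep_eq cscale.rep_eq delta.rep_eq by (rule infsum_cong_neutral) auto
  then show ?thesis by simp
qed

section \<open>Existence of adjoints\<close>

lift_definition truncate :: "'g set \<Rightarrow> 'g ell2 \<Rightarrow> 'g ell2" is
  "\<lambda>K f g. if g \<in> K then f g else 0"
proof -
  fix K :: "'g set" and f :: "'g \<Rightarrow> complex"
  assume f: "(\<lambda>g. (cmod (f g))\<^sup>2) summable_on UNIV"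
  show "(\<lambda>g. (cmod (if g \<in> K then f g else 0))\<^sup>2) summable_on UNIV"
    by (rule summable_on_comparison_test[OF f]) auto
qed

lemma norm_truncate_le: "norm (truncate K x) \<le> norm x"
  unfolding norm_ell2_eq real_sqrt_le_iff
  by (intro infsum_mono cmod_sq_summable) (simp add: truncate.rep_eq)

lemma truncate_eq_sum:
  "finite F \<Longrightarrow> truncate F x = (\<Sum>g\<in>F. cscale (ell2_fun x g) (delta g))"
proof (induction F rule: finite_induct)
  case empty
  show ?case by (rule ell2_eqI) (simp add: truncate.rep_eq zero_ell2.rep_eq)
next
  case (insert g F)
  have "truncate (insert g F) x = cscale (ell2_fun x g) (delta g) + truncate F x"
    using insert.hyps
    by (intro ell2_eqI) (auto simp: truncate.rep_eq plus_ell2.rep_eq cscale.rep_eq delta.rep_eq)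
  with insert show ?case by simp
qed

lemma norm_truncate_finite:
  assumes "finite F"
  shows "(norm (truncate F x))\<^sup>2 = (\<Sum>g\<in>F. (cmod (ell2_fun x g))\<^sup>2)"
proof -
  have "(norm (truncate F x))\<^sup>2 = (\<Sum>\<^sub>\<infinity>g\<in>F. (cmod (ell2_fun x g))\<^sup>2)"
    unfolding norm_ell2_power2 truncate.rep_eq by (rule infsum_cong_neutral) auto
  with assms show ?thesis by simp
qed

lemma truncate_tendsto: "((\<lambda>F. truncate F x) \<longlongrightarrow> x) (finite_subsets_at_top UNIV)"
proof -
  have sq: "(norm (truncate F x - x))\<^sup>2 = (norm x)\<^sup>2 - (\<Sum>g\<in>F. (cmod (ell2_fun x g))\<^sup>2)"
    if "finite F" for F
  proof -
    have "truncate F x \<bullet> (x - truncate F x) = 0"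
      unfolding inner_ell2.rep_eq by (rule infsum_0) (simp add: minus_ell2.rep_eq truncate.rep_eq)
    then have "(norm (truncate F x - x))\<^sup>2 = (norm x)\<^sup>2 - (norm (truncate F x))\<^sup>2"
      by (simp add: power2_norm_eq_inner inner_diff inner_commute)
    with that show ?thesis by (simp add: norm_truncate_finite)
  qed
  have "((\<lambda>F. \<Sum>g\<in>F. (cmod (ell2_fun x g))\<^sup>2) \<longlongrightarrow> (norm x)\<^sup>2) (finite_subsets_at_top UNIV)"
    using has_sum_infsum[OF cmod_sq_summable, of x] by (simp add: has_sum_def norm_ell2_power2)
  then have "((\<lambda>F. sqrt ((norm x)\<^sup>2 - (\<Sum>g\<in>F. (cmod (ell2_fun x g))\<^sup>2))) \<longlongrightarrow>
      sqrt ((norm x)\<^sup>2 - (norm x)\<^sup>2)) (finite_subsets_at_top UNIV)"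
    by (intro tendsto_intros)
  moreover have "\<forall>\<^sub>F F in finite_subsets_at_top UNIV.
      sqrt ((norm x)\<^sup>2 - (\<Sum>g\<in>F. (cmod (ell2_fun x g))\<^sup>2)) = norm (truncate F x - x)"
    by (intro eventually_finite_subsets_at_top_weakI) (simp add: sq[symmetric])
  ultimately have "((\<lambda>F. norm (truncate F x - x)) \<longlongrightarrow> 0) (finite_subsets_at_top UNIV)"
    by (auto dest: Lim_transform_eventually)
  then show ?thesis
    by (simp add: tendsto_norm_zero_iff LIM_zero_iff)
qed

text \<open>The Riesz representation is explicit here: the only candidate for \<open>S y\<close> has the coefficients
  \<open>\<langle>y, T \<delta>\<^sub>g\<rangle>\<close>, and pairing \<open>y\<close> with \<open>T\<close> applied to its finite truncations bounds its norm.\<close>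

lemma adjoint_exists:
  fixes T :: "'g ell2 \<Rightarrow>\<^sub>L 'g ell2"
  assumes T: "T \<in> bounded_ops"
  obtains S where "S \<in> bounded_ops" "\<And>x y. T x \<bullet> y = x \<bullet> S y"
proof -
  define f where "f y g = cinner y (T (delta g))" for y g
  have T_delta: "T (cscale c (delta g)) \<bullet> y = c \<bullet> f y g" for c g y
  proof -
    have "T (cscale c (delta g)) \<bullet> y = Re (c * cinner (T (delta g)) y)"
      using T by (simp add: bounded_ops_def Re_cinner[symmetric] cinner_cscale_left)
    also have "cinner (T (delta g)) y = cnj (f y g)"
      by (simp add: f_def cinner_commute[of _ y])
    finally show ?thesis by (simp add: inner_complex_def)
  qed
  have "\<exists>z. ell2_fun z = f y \<and> norm z \<le> norm T * norm y" for y
  proof (rule ell2_of_finite_bounds)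
    fix F :: "'g set" assume F: "finite F"
    define v where "v = (\<Sum>g\<in>F. cscale (f y g) (delta g))"
    define s where "s = (\<Sum>g\<in>F. (cmod (f y g))\<^sup>2)"
    have s: "T v \<bullet> y = s"
      by (simp add: v_def s_def blinfun.sum_right inner_sum_left T_delta power2_norm_eq_inner)
    have coeff: "ell2_fun v g = (if g \<in> F then f y g else 0)" for g
      using F unfolding v_def
      by (induction F rule: finite_induct)
        (auto simp: zero_ell2.rep_eq plus_ell2.rep_eq cscale.rep_eq delta.rep_eq)
    have "v = truncate F v"
      by (rule ell2_eqI) (simp add: truncate.rep_eq coeff)
    then have v: "(norm v)\<^sup>2 = s"
      using norm_truncate_finite[OF F, of v] by (simp add: coeff s_def)
    have "(norm v)\<^sup>2 \<le> norm (T v) * norm y"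
      using Cauchy_Schwarz_ineq2[of "T v" y] s v by simp
    also have "\<dots> \<le> norm v * (norm T * norm y)"
      using mult_right_mono[OF norm_blinfun[of T v], of "norm y"] by (simp add: mult_ac)
    finally have "norm v \<le> norm T * norm y"
      by (cases "norm v = 0") (auto simp: power2_eq_square)
    then show "(\<Sum>g\<in>F. (cmod (f y g))\<^sup>2) \<le> (norm T * norm y)\<^sup>2"
      unfolding s_def[symmetric] v[symmetric] by (intro power_mono) auto
  qed auto
  then obtain S where S: "ell2_fun (S y) = f y" "norm (S y) \<le> norm T * norm y" for y
    by metis
  have "bounded_linear S"
    by (rule bounded_linear_intro[where K = "norm T"])
      (auto intro!: ell2_eqI simp: S plus_ell2.rep_eq scaleR_ell2.rep_eq f_def cinner_add_left
        cinner_scaleR_left mult.commute[of "norm _" "norm T"])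
  then have app: "Blinfun S y = S y" for y
    by (simp add: bounded_linear_Blinfun_apply)
  show ?thesis
  proof
    have "S (cscale c x) = cscale c (S x)" for c x
      by (rule ell2_eqI) (simp add: S cscale.rep_eq f_def cinner_cscale_left)
    then show "Blinfun S \<in> bounded_ops"
      by (simp add: bounded_ops_def app)
    fix x y
    have "T (truncate F x) \<bullet> y = truncate F x \<bullet> S y" if "finite F" for F
    proof -
      have "cscale c (delta g) \<bullet> S y = c \<bullet> f y g" for c g
        using inner_delta[of "S y" c g] by (simp add: S inner_commute)
      then show ?thesis
        using that by (simp add: truncate_eq_sum blinfun.sum_right inner_sum_left T_delta)
    qed
    then have "\<forall>\<^sub>F F in finite_subsets_at_top UNIV. T (truncate F x) \<bullet> y = truncate F x \<bullet> S y"
      by (intro eventually_finite_subsets_at_top_weakI)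
    moreover have "((\<lambda>F. T (truncate F x) \<bullet> y) \<longlongrightarrow> T x \<bullet> y) (finite_subsets_at_top UNIV)"
      by (intro tendsto_intros truncate_tendsto)
    ultimately have "((\<lambda>F. truncate F x \<bullet> S y) \<longlongrightarrow> T x \<bullet> y) (finite_subsets_at_top UNIV)"
      by (rule Lim_transform_eventually[rotated])
    moreover have "((\<lambda>F. truncate F x \<bullet> S y) \<longlongrightarrow> x \<bullet> S y) (finite_subsets_at_top UNIV)"
      by (intro tendsto_intros truncate_tendsto)
    ultimately have "T x \<bullet> y = x \<bullet> S y"
      by (rule tendsto_unique[OF finite_subsets_at_top_neq_bot])
    then show "T x \<bullet> y = x \<bullet> Blinfun S y"
      by (simp add: app)
  qed
qed

lemma adj_eqI_inner:
  assumes "S \<in> bounded_ops" "\<And>x y. blinfun_apply T x \<bullet> y = x \<bullet> blinfun_apply S y"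
  shows "adj T = S"
  using assms by (intro adj_eqI) (auto simp: cinner_eq_Complex_inner bounded_ops_def)

lemma adj_bounded_ops: "T \<in> bounded_ops \<Longrightarrow> adj T \<in> bounded_ops"
  by (metis adj_eqI_inner adjoint_exists)

lemma inner_adj: "T \<in> bounded_ops \<Longrightarrow> blinfun_apply T x \<bullet> y = x \<bullet> blinfun_apply (adj T) y"
  by (metis adj_eqI_inner adjoint_exists)

lemma tr_norm_eq:
  assumes "T \<in> bounded_ops"
  shows "tr_norm G T = norm (T (delta \<one>\<^bsub>G\<^esub>))"
  by (simp add: tr_norm_def tr_def Re_cinner inner_commute[of "adj T _"]
      inner_adj[OF assms, symmetric] norm_eq_sqrt_inner)

section \<open>Blaschke factors of a unitary operator\<close>

definition geometric_series :: "real \<Rightarrow> ('a \<Rightarrow>\<^sub>L 'a) \<Rightarrow> ('a::banach \<Rightarrow>\<^sub>L 'a)" where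
  "geometric_series \<alpha> U = (\<Sum>n. \<alpha> ^ n *\<^sub>R (((o\<^sub>L) U) ^^ n) id_blinfun)"

text \<open>This is \<open>(U - \<alpha>) (1 - \<alpha> U)\<inverse>\<close>, the operator obtained from the disc automorphism
  \<open>z \<mapsto> (z - \<alpha>) / (1 - \<alpha> z)\<close>.\<close>

definition blaschke :: "real \<Rightarrow> ('a \<Rightarrow>\<^sub>L 'a) \<Rightarrow> ('a::banach \<Rightarrow>\<^sub>L 'a)" where
  "blaschke \<alpha> U = (U - \<alpha> *\<^sub>R id_blinfun) o\<^sub>L geometric_series \<alpha> U"

lemma norm_isometry_le:
  fixes U :: "'a::real_inner \<Rightarrow>\<^sub>L 'a"
  assumes "\<And>x y. blinfun_apply U x \<bullet> blinfun_apply U y = x \<bullet> y"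
  shows "norm U \<le> 1"
  by (rule norm_blinfun_bound) (simp_all add: norm_eq_sqrt_inner assms)

context
  fixes \<alpha> :: real and U :: "'a::banach \<Rightarrow>\<^sub>L 'a"
  assumes \<alpha>: "\<bar>\<alpha>\<bar> < 1" and U: "norm U \<le> 1"
begin

lemma geometric_series_sums:
  "(\<lambda>n. \<alpha> ^ n *\<^sub>R (((o\<^sub>L) U) ^^ n) id_blinfun) sums geometric_series \<alpha> U"
proof -
  have pow: "norm ((((o\<^sub>L) U) ^^ n) id_blinfun) \<le> 1" for n
  proof (induction n)
    case (Suc n)
    have "norm ((((o\<^sub>L) U) ^^ Suc n) id_blinfun) \<le> norm U * norm ((((o\<^sub>L) U) ^^ n) id_blinfun)"
      by (simp add: norm_blinfun_compose)
    also have "\<dots> \<le> 1 * 1"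
      using Suc U by (intro mult_mono) auto
    finally show ?case by simp
  qed (simp add: norm_blinfun_id_le)
  have "summable (\<lambda>n. \<alpha> ^ n *\<^sub>R (((o\<^sub>L) U) ^^ n) id_blinfun)"
  proof (rule summable_comparison_test')
    show "summable (\<lambda>n. \<bar>\<alpha>\<bar> ^ n)"
      using \<alpha> by (simp add: summable_geometric)
    fix n
    show "norm (\<alpha> ^ n *\<^sub>R (((o\<^sub>L) U) ^^ n) id_blinfun) \<le> \<bar>\<alpha>\<bar> ^ n"
      using mult_left_mono[OF pow, of "\<bar>\<alpha>\<bar> ^ n" n] by (simp add: power_abs)
  qed
  then show ?thesis
    unfolding geometric_series_def by (rule summable_sums)
qed

lemma geometric_series_apply:
  "geometric_series \<alpha> U x = x + \<alpha> *\<^sub>R U (geometric_series \<alpha> U x)"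
proof -
  let ?p = "\<lambda>n. \<alpha> ^ n *\<^sub>R (((o\<^sub>L) U) ^^ n) id_blinfun"
  have "(\<lambda>n. \<alpha> *\<^sub>R (U o\<^sub>L ?p n)) sums (\<alpha> *\<^sub>R (U o\<^sub>L geometric_series \<alpha> U))"
    by (intro sums_scaleR_right geometric_series_sums
        bounded_linear.sums[OF bounded_bilinear.bounded_linear_right[OF
          bounded_bilinear_blinfun_compose]])
  moreover have "\<alpha> *\<^sub>R (U o\<^sub>L ?p n) = ?p (Suc n)" for n
    by (rule blinfun_eqI) (simp add: blinfun.scaleR_left blinfun.scaleR_right)
  ultimately have "(\<lambda>n. ?p (Suc n)) sums (\<alpha> *\<^sub>R (U o\<^sub>L geometric_series \<alpha> U))"
    by simp
  from sums_Suc[OF this]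
  have "?p sums (id_blinfun + \<alpha> *\<^sub>R (U o\<^sub>L geometric_series \<alpha> U))"
    by (simp add: add.commute)
  with geometric_series_sums
  have "geometric_series \<alpha> U = id_blinfun + \<alpha> *\<^sub>R (U o\<^sub>L geometric_series \<alpha> U)"
    by (rule sums_unique2)
  from arg_cong[OF this, of "\<lambda>T. blinfun_apply T x"] show ?thesis
    unfolding blinfun.add_left blinfun.scaleR_left blinfun_apply_blinfun_compose
      blinfun_apply_id_blinfun .
qed

lemma geometric_series_commute:
  assumes T: "T o\<^sub>L U = U o\<^sub>L T"
  shows "T o\<^sub>L geometric_series \<alpha> U = geometric_series \<alpha> U o\<^sub>L T"
proof -
  let ?p = "\<lambda>n. \<alpha> ^ n *\<^sub>R (((o\<^sub>L) U) ^^ n) id_blinfun"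
  have TU: "T (U x) = U (T x)" for x
    using T by (metis blinfun_apply_blinfun_compose)
  have "T ((((o\<^sub>L) U ^^ n) id_blinfun) x) = (((o\<^sub>L) U ^^ n) id_blinfun) (T x)" for n x
    by (induction n arbitrary: x) (simp_all add: TU)
  then have eq: "T o\<^sub>L ?p n = ?p n o\<^sub>L T" for n
    by (intro blinfun_eqI) (simp add: blinfun.scaleR_left blinfun.scaleR_right)
  have "(\<lambda>n. T o\<^sub>L ?p n) sums (T o\<^sub>L geometric_series \<alpha> U)"
    by (intro geometric_series_sums bounded_linear.sums[OF
          bounded_bilinear.bounded_linear_right[OF bounded_bilinear_blinfun_compose]])
  moreover have "(\<lambda>n. T o\<^sub>L ?p n) sums (geometric_series \<alpha> U o\<^sub>L T)"
    unfolding eq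
    by (intro geometric_series_sums bounded_linear.sums[OF
          bounded_bilinear.bounded_linear_left[OF bounded_bilinear_blinfun_compose]])
  ultimately show ?thesis
    by (rule sums_unique2)
qed

lemma blaschke_apply:
  "blaschke \<alpha> U x = U (geometric_series \<alpha> U x) - \<alpha> *\<^sub>R geometric_series \<alpha> U x"
  by (simp add: blaschke_def blinfun.diff_left blinfun.scaleR_left)

lemma blaschke_commute:
  assumes T: "T o\<^sub>L U = U o\<^sub>L T"
  shows "T o\<^sub>L blaschke \<alpha> U = blaschke \<alpha> U o\<^sub>L T"
proof (rule blinfun_eqI)
  fix x
  have "T (U y) = U (T y)" "T (geometric_series \<alpha> U y) = geometric_series \<alpha> U (T y)" for y
    using T geometric_series_commute[OF T] by (metis blinfun_apply_blinfun_compose)+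
  then show "(T o\<^sub>L blaschke \<alpha> U) x = (blaschke \<alpha> U o\<^sub>L T) x"
    by (simp add: blaschke_apply blinfun.diff_right blinfun.scaleR_right)
qed

end

text \<open>On the unit circle \<open>\<bar>z - \<alpha>\<bar> = \<bar>1 - \<alpha> z\<bar>\<close>; the same computation with inner products in
  place of moduli shows that \<open>U - \<alpha>\<close> and \<open>1 - \<alpha> U\<close> have the same Gram form.\<close>

lemma blaschke_isometry:
  fixes U :: "'a::{real_inner,banach} \<Rightarrow>\<^sub>L 'a"
  assumes \<alpha>: "\<bar>\<alpha>\<bar> < 1" and U: "\<And>x y. blinfun_apply U x \<bullet> blinfun_apply U y = x \<bullet> y"
  shows "blaschke \<alpha> U x \<bullet> blaschke \<alpha> U y = x \<bullet> y"
proof -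
  note U' = norm_isometry_le[OF U]
  define p q where "p = geometric_series \<alpha> U x" and "q = geometric_series \<alpha> U y"
  have xy: "x = p - \<alpha> *\<^sub>R U p" "y = q - \<alpha> *\<^sub>R U q"
    using geometric_series_apply[OF \<alpha> U', of x] geometric_series_apply[OF \<alpha> U', of y]
    by (simp_all add: p_def q_def algebra_simps)
  have "blaschke \<alpha> U x \<bullet> blaschke \<alpha> U y = (U p - \<alpha> *\<^sub>R p) \<bullet> (U q - \<alpha> *\<^sub>R q)"
    by (simp only: blaschke_apply[OF \<alpha> U'] p_def q_def)
  also have "\<dots> = (p - \<alpha> *\<^sub>R U p) \<bullet> (q - \<alpha> *\<^sub>R U q)"
    by (simp add: inner_diff_left inner_diff_right U algebra_simps)
  also have "\<dots> = x \<bullet> y"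
    by (simp only: xy[symmetric])
  finally show ?thesis .
qed

text \<open>For commuting \<open>U\<close> and \<open>U'\<close> with product 1, both \<open>(U - \<alpha>) (U' - \<alpha>)\<close> and \<open>(1 - \<alpha> U) (1 - \<alpha> U')\<close>
  expand to \<open>1 - \<alpha> U - \<alpha> U' + \<alpha>\<^sup>2\<close>, so the numerators cancel the denominators.\<close>

lemma blaschke_inverse:
  fixes U U' :: "'a::banach \<Rightarrow>\<^sub>L 'a"
  assumes \<alpha>: "\<bar>\<alpha>\<bar> < 1" and U: "norm U \<le> 1" and U': "norm U' \<le> 1"
    and inv: "U o\<^sub>L U' = id_blinfun" "U' o\<^sub>L U = id_blinfun"
  shows "blaschke \<alpha> U o\<^sub>L blaschke \<alpha> U' = id_blinfun"
proof (rule blinfun_eqI)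
  fix x
  have inv_apply: "U (U' y) = y" "U' (U y) = y" for y
    using inv by (metis blinfun_apply_blinfun_compose blinfun_apply_id_blinfun)+
  have "U' o\<^sub>L geometric_series \<alpha> U = geometric_series \<alpha> U o\<^sub>L U'"
    by (rule geometric_series_commute[OF \<alpha> U]) (simp add: inv)
  then have comm: "geometric_series \<alpha> U (U' y) = U' (geometric_series \<alpha> U y)" for y
    by (metis blinfun_apply_blinfun_compose)
  define y where "y = geometric_series \<alpha> U' x"
  define z where "z = geometric_series \<alpha> U y"
  have x: "x = y - \<alpha> *\<^sub>R U' y"
    using geometric_series_apply[OF \<alpha> U', of x] by (simp add: y_def algebra_simps)
  have y: "y = z - \<alpha> *\<^sub>R U z"
    using geometric_series_apply[OF \<alpha> U, of y] by (simp add: z_def algebra_simps)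
  have "geometric_series \<alpha> U (blaschke \<alpha> U' x) = U' z - \<alpha> *\<^sub>R z"
    unfolding blaschke_apply[OF \<alpha> U'] blinfun.diff_right blinfun.scaleR_right comm
    by (simp add: y_def z_def)
  then have "blaschke \<alpha> U (blaschke \<alpha> U' x) = U (U' z - \<alpha> *\<^sub>R z) - \<alpha> *\<^sub>R (U' z - \<alpha> *\<^sub>R z)"
    by (simp add: blaschke_apply[OF \<alpha> U])
  also have "\<dots> = x"
    unfolding x y
    by (simp add: inv_apply blinfun.diff_right blinfun.scaleR_right algebra_simps)
  finally show "(blaschke \<alpha> U o\<^sub>L blaschke \<alpha> U') x = blinfun_apply id_blinfun x"
    by simp
qed

lift_definition scalar_op :: "complex \<Rightarrow> 'g ell2 \<Rightarrow>\<^sub>L 'g ell2" is cscale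
proof (rule bounded_linear_intro)
  fix c x
  show "norm (cscale c x) \<le> norm x * cmod c"
    by (simp add: norm_cscale)
qed (auto intro!: ell2_eqI simp: cscale.rep_eq plus_ell2.rep_eq scaleR_ell2.rep_eq algebra_simps)

text \<open>Complex linearity is itself a commutation property, so power series in an operator inherit it.\<close>

lemma bounded_ops_iff: "T \<in> bounded_ops \<longleftrightarrow> (\<forall>c. T o\<^sub>L scalar_op c = scalar_op c o\<^sub>L T)"
proof -
  have "T o\<^sub>L scalar_op c = scalar_op c o\<^sub>L T \<longleftrightarrow> (\<forall>x. T (cscale c x) = cscale c (T x))" for c
    by (metis blinfun_apply_blinfun_compose blinfun_eqI scalar_op.rep_eq)
  then show ?thesis by (simp add: bounded_ops_def)
qed

lemma blaschke_bounded_ops: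
  assumes "\<bar>\<alpha>\<bar> < 1" "norm U \<le> 1" "U \<in> bounded_ops"
  shows "blaschke \<alpha> U \<in> bounded_ops"
  unfolding bounded_ops_iff
proof
  fix c
  have "scalar_op c o\<^sub>L U = U o\<^sub>L scalar_op c"
    using assms(3) by (simp add: bounded_ops_iff)
  then show "blaschke \<alpha> U o\<^sub>L scalar_op c = scalar_op c o\<^sub>L blaschke \<alpha> U"
    using assms(1,2) by (rule blaschke_commute[symmetric, rotated 2])
qed

text \<open>An isometry with a right inverse has that inverse as its adjoint.\<close>

lemma adj_blaschke:
  fixes U U' :: "'g ell2 \<Rightarrow>\<^sub>L 'g ell2"
  assumes \<alpha>: "\<bar>\<alpha>\<bar> < 1"
    and U: "\<And>x y. blinfun_apply U x \<bullet> blinfun_apply U y = x \<bullet> y"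
    and U': "\<And>x y. blinfun_apply U' x \<bullet> blinfun_apply U' y = x \<bullet> y" "U' \<in> bounded_ops"
    and inv: "U o\<^sub>L U' = id_blinfun" "U' o\<^sub>L U = id_blinfun"
  shows "adj (blaschke \<alpha> U) = blaschke \<alpha> U'"
proof (rule adj_eqI_inner)
  show "blaschke \<alpha> U' \<in> bounded_ops"
    by (intro blaschke_bounded_ops norm_isometry_le \<alpha> U')
  fix x y
  have "blaschke \<alpha> U (blaschke \<alpha> U' y) = y"
    using blaschke_inverse[OF \<alpha> norm_isometry_le[OF U] norm_isometry_le[OF U'(1)] inv]
    by (metis blinfun_apply_blinfun_compose blinfun_apply_id_blinfun)
  then show "blaschke \<alpha> U x \<bullet> y = x \<bullet> blaschke \<alpha> U' y"
    using blaschke_isometry[OF \<alpha> U, of x "blaschke \<alpha> U' y"] by simp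
qed

section \<open>Operators permuting the coordinates\<close>

definition perm_op :: "('g \<Rightarrow> 'g) \<Rightarrow> ('g ell2 \<Rightarrow>\<^sub>L 'g ell2)" where
  "perm_op \<pi> = Blinfun (\<lambda>x. Abs_ell2 (\<lambda>h. ell2_fun x (\<pi> h)))"

context
  fixes \<pi> :: "'g \<Rightarrow> 'g"
  assumes \<pi>: "bij \<pi>"
begin

lemma ell2_fun_perm_op: "ell2_fun (perm_op \<pi> x) h = ell2_fun x (\<pi> h)"
proof -
  define L where "L = (\<lambda>x. Abs_ell2 (\<lambda>h. ell2_fun x (\<pi> h)))"
  have L: "ell2_fun (L x) = (\<lambda>h. ell2_fun x (\<pi> h))" for x
    unfolding L_def using summable_on_reindex_bij_betw[OF \<pi>, of "\<lambda>k. (cmod (ell2_fun x k))\<^sup>2"]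
    by (simp add: Abs_ell2_inverse cmod_sq_summable)
  have "norm (L x) = norm x" for x
    unfolding norm_ell2_eq L
    using infsum_reindex_bij_betw[OF \<pi>, of "\<lambda>k. (cmod (ell2_fun x k))\<^sup>2"] by simp
  then have "bounded_linear L"
    by (intro bounded_linear_intro[where K = 1])
      (auto intro!: ell2_eqI simp: L plus_ell2.rep_eq scaleR_ell2.rep_eq)
  then have "perm_op \<pi> x = L x"
    by (simp add: perm_op_def L_def bounded_linear_Blinfun_apply)
  then show ?thesis by (simp add: L)
qed

lemma perm_op_isometry: "perm_op \<pi> x \<bullet> perm_op \<pi> y = x \<bullet> y"
  unfolding inner_ell2.rep_eq ell2_fun_perm_op
  using infsum_reindex_bij_betw[OF \<pi>, of "\<lambda>k. ell2_fun x k \<bullet> ell2_fun y k"] by simp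

lemma perm_op_bounded_ops: "perm_op \<pi> \<in> bounded_ops"
  by (auto simp: bounded_ops_def ell2_fun_perm_op cscale.rep_eq intro!: ell2_eqI)

text \<open>This is the power series \<open>-\<alpha> + (1 - \<alpha>\<^sup>2) (z + \<alpha> z\<^sup>2 + \<alpha>\<^sup>2 z\<^sup>3 + \<dots>)\<close> of the disc automorphism,
  evaluated at the permutation operator and read off in one coordinate.\<close>

lemma ell2_fun_blaschke_perm_op:
  assumes \<alpha>: "\<bar>\<alpha>\<bar> < 1"
  shows "ell2_fun (blaschke \<alpha> (perm_op \<pi>) x) h =
    - of_real \<alpha> * ell2_fun x h +
    of_real (1 - \<alpha>\<^sup>2) * (\<Sum>n. of_real (\<alpha> ^ n) * ell2_fun x ((\<pi> ^^ Suc n) h))"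
proof -
  note U = norm_isometry_le[OF perm_op_isometry]
  define y where "y = geometric_series \<alpha> (perm_op \<pi>) x"
  have pow: "ell2_fun ((((o\<^sub>L) (perm_op \<pi>) ^^ n) id_blinfun) x) k = ell2_fun x ((\<pi> ^^ n) k)" for n k
    by (induction n arbitrary: k) (simp_all add: ell2_fun_perm_op funpow_swap1[of \<pi>])
  have "bounded_linear (\<lambda>T :: 'g ell2 \<Rightarrow>\<^sub>L 'g ell2. ell2_fun (T x) (\<pi> h))"
    by (intro bounded_linear_compose[OF bounded_linear_ell2_fun] blinfun.bounded_linear_left)
  from bounded_linear.sums[OF this geometric_series_sums[OF \<alpha> U]]
  have "ell2_fun y (\<pi> h) = (\<Sum>n. of_real (\<alpha> ^ n) * ell2_fun x ((\<pi> ^^ Suc n) h))"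
    by (simp add: y_def blinfun.scaleR_left scaleR_ell2.rep_eq pow funpow_swap1[of \<pi>] scaleR_conv_of_real
        sums_iff)
  moreover have "ell2_fun y h = ell2_fun x h + of_real \<alpha> * ell2_fun y (\<pi> h)"
    using arg_cong[OF geometric_series_apply[OF \<alpha> U, of x], of "\<lambda>v. ell2_fun v h"]
    by (simp add: y_def plus_ell2.rep_eq scaleR_ell2.rep_eq ell2_fun_perm_op scaleR_conv_of_real)
  moreover have "ell2_fun (blaschke \<alpha> (perm_op \<pi>) x) h = ell2_fun y (\<pi> h) - of_real \<alpha> * ell2_fun y h"
    by (simp add: blaschke_apply[OF \<alpha> U] y_def minus_ell2.rep_eq scaleR_ell2.rep_eq
        ell2_fun_perm_op scaleR_conv_of_real)
  ultimately show ?thesis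
    by (simp add: algebra_simps power2_eq_square)
qed

end

section \<open>Commutants and unit balls\<close>

lemma bounded_ops_diff: "S \<in> bounded_ops \<Longrightarrow> T \<in> bounded_ops \<Longrightarrow> S - T \<in> bounded_ops"
  by (auto intro!: ell2_eqI simp: bounded_ops_def blinfun.diff_left cscale.rep_eq
      minus_ell2.rep_eq right_diff_distrib)

lemma bounded_ops_compose: "S \<in> bounded_ops \<Longrightarrow> T \<in> bounded_ops \<Longrightarrow> S o\<^sub>L T \<in> bounded_ops"
  by (simp add: bounded_ops_def)

lemma commutant_bounded_ops: "T \<in> commutant S \<Longrightarrow> T \<in> bounded_ops"
  by (simp add: commutant_def)

lemma commutant_apply: "T \<in> commutant S \<Longrightarrow> s \<in> S \<Longrightarrow> T (s x) = s (T x)"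
  unfolding commutant_def by (metis (mono_tags, lifting) blinfun_apply_blinfun_compose mem_Collect_eq)

lemma subset_bicommutant: "S \<subseteq> bounded_ops \<Longrightarrow> S \<subseteq> commutant (commutant S)"
  by (auto simp: commutant_def)

lemma scalar_op_commutant: "S \<subseteq> bounded_ops \<Longrightarrow> scalar_op c \<in> commutant S"
  by (auto simp: commutant_def bounded_ops_def scalar_op.rep_eq cscale.rep_eq
      intro!: blinfun_eqI ell2_eqI)

lemma commutant_lincomb:
  assumes S: "S \<subseteq> bounded_ops" and T: "T1 \<in> commutant S" "T2 \<in> commutant S"
  shows "r1 *\<^sub>R T1 + r2 *\<^sub>R T2 \<in> commutant S"
proof -
  have "r1 *\<^sub>R T1 + r2 *\<^sub>R T2 \<in> bounded_ops"
    using T[THEN commutant_bounded_ops]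
    by (auto simp: bounded_ops_def blinfun.add_left blinfun.scaleR_left cscale.rep_eq
        scaleR_ell2.rep_eq plus_ell2.rep_eq algebra_simps intro!: ell2_eqI)
  moreover have "(r1 *\<^sub>R T1 + r2 *\<^sub>R T2) o\<^sub>L s = s o\<^sub>L (r1 *\<^sub>R T1 + r2 *\<^sub>R T2)" if "s \<in> S" for s
    by (rule blinfun_eqI)
      (simp add: blinfun.add_left blinfun.scaleR_left blinfun.add_right blinfun.scaleR_right
        commutant_apply[OF T(1) that] commutant_apply[OF T(2) that])
  ultimately show ?thesis by (simp add: commutant_def)
qed

lift_definition truncate_op :: "'g set \<Rightarrow> 'g ell2 \<Rightarrow>\<^sub>L 'g ell2" is truncate
proof (rule bounded_linear_intro)
  fix K :: "'g set" and x
  show "norm (truncate K x) \<le> norm x * 1"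
    by (simp add: norm_truncate_le)
qed (auto intro!: ell2_eqI simp: truncate.rep_eq plus_ell2.rep_eq scaleR_ell2.rep_eq)

lemma unitary_op_isometry:
  assumes "unitary_op u"
  shows "norm (u x) = norm x" and "norm (adj u x) = norm x"
proof -
  have u: "u \<in> bounded_ops" "u (adj u y) = y" "adj u (u y) = y" for y
    using assms unfolding unitary_op_def
    by (metis blinfun_apply_blinfun_compose blinfun_apply_id_blinfun)+
  show "norm (u x) = norm x"
    using inner_adj[OF u(1), of x "u x"] by (simp add: u norm_eq_sqrt_inner)
  show "norm (adj u x) = norm x"
    using inner_adj[OF u(1), of "adj u x" x] by (simp add: u norm_eq_sqrt_inner)
qed

lemma unit_ball_conj_by:
  assumes u: "unitary_op u"
  shows "unit_ball (conj_by u P) = (\<lambda>x. u o\<^sub>L x o\<^sub>L adj u) ` unit_ball P"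
proof -
  have bounds: "norm u \<le> 1" "norm (adj u) \<le> 1"
    by (auto intro!: norm_blinfun_bound simp: unitary_op_isometry[OF u])
  have contract: "norm (v o\<^sub>L x o\<^sub>L w) \<le> norm x"
    if "norm v \<le> 1" "norm w \<le> 1" for v x w :: "'a ell2 \<Rightarrow>\<^sub>L 'a ell2"
  proof -
    have "norm (v o\<^sub>L x o\<^sub>L w) \<le> norm v * norm x * norm w"
      by (meson norm_blinfun_compose mult_right_mono norm_ge_zero order_trans)
    also have "\<dots> \<le> 1 * norm x * 1"
      using that by (intro mult_mono) auto
    finally show ?thesis by simp
  qed
  have "norm (u o\<^sub>L x o\<^sub>L adj u) = norm x" for x
  proof (rule antisym)
    have "adj u o\<^sub>L (u o\<^sub>L x o\<^sub>L adj u) o\<^sub>L u = x"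
      using u unfolding unitary_op_def
      by (intro blinfun_eqI) (metis blinfun_apply_blinfun_compose blinfun_apply_id_blinfun)
    then show "norm x \<le> norm (u o\<^sub>L x o\<^sub>L adj u)"
      using contract[OF bounds(2,1), of "u o\<^sub>L x o\<^sub>L adj u"] by simp
  qed (rule contract[OF bounds])
  then show ?thesis
    by (auto simp: unit_ball_def conj_by_def)
qed

lemma SUP_INF_attained:
  fixes D :: "'a \<Rightarrow> 'b \<Rightarrow> real"
  assumes lower: "\<And>x y. x \<in> A \<Longrightarrow> y \<in> B \<Longrightarrow> m x \<le> D x y"
    and attained: "\<And>x. x \<in> A \<Longrightarrow> \<exists>y\<in>B. D x y = m x"
    and upper: "\<And>x. x \<in> A \<Longrightarrow> m x \<le> c" and "x0 \<in> A" "m x0 = c"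
  shows "(SUP x\<in>A. INF y\<in>B. D x y) = c"
proof -
  have "(INF y\<in>B. D x y) = m x" if "x \<in> A" for x
  proof (rule cInf_eq_minimum)
    show "m x \<in> D x ` B"
      using attained[OF that] by (metis imageI)
  qed (use lower[OF that] in auto)
  then have "(SUP x\<in>A. INF y\<in>B. D x y) = (SUP x\<in>A. m x)"
    by simp
  also have "\<dots> = c"
    by (rule cSup_eq_maximum) (use assms in auto)
  finally show ?thesis .
qed

section \<open>Subgroup algebras conjugated by a unitary\<close>

context
  fixes G :: "('g, 'm) monoid_scheme"
  assumes G: "group G" and carrier_G: "carrier G = UNIV"
begin

interpretation group G by (rule G)

lemma left_reg_eq_perm_op: "left_reg G g = perm_op (\<lambda>h. inv\<^bsub>G\<^esub> g \<otimes>\<^bsub>G\<^esub> h)"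
  by (intro blinfun_eqI ell2_eqI)
    (simp add: ell2_fun_left_reg[OF G carrier_G] ell2_fun_perm_op[OF bij_left_mult[OF G carrier_G]])

lemma bij_right_mult: "bij (\<lambda>h. h \<otimes>\<^bsub>G\<^esub> g)"
  by (rule bij_betw_byWitness[where f' = "\<lambda>h. h \<otimes>\<^bsub>G\<^esub> inv\<^bsub>G\<^esub> g"])
    (auto simp: carrier_G m_assoc)

lemma left_reg_delta: "left_reg G g (delta \<one>\<^bsub>G\<^esub>) = delta g"
  by (rule ell2_eqI)
    (auto simp: ell2_fun_left_reg[OF G carrier_G] delta.rep_eq carrier_G inv_solve_left')

text \<open>The projection onto \<open>\<ell>\<^sup>2(H)\<close> commutes with the translations by \<open>H\<close>, hence with every element
  of \<open>L(H)\<close>.\<close>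

lemma group_vN_support:
  assumes H: "subgroup H G" and x: "x \<in> group_vN G H" and g: "g \<notin> H"
  shows "ell2_fun (x (delta \<one>\<^bsub>G\<^esub>)) g = 0"
proof -
  have H_shift: "inv\<^bsub>G\<^esub> h \<otimes>\<^bsub>G\<^esub> k \<in> H \<longleftrightarrow> k \<in> H" if "h \<in> H" for h k
  proof
    assume "inv\<^bsub>G\<^esub> h \<otimes>\<^bsub>G\<^esub> k \<in> H"
    then have "h \<otimes>\<^bsub>G\<^esub> (inv\<^bsub>G\<^esub> h \<otimes>\<^bsub>G\<^esub> k) \<in> H"
      by (rule subgroup.m_closed[OF H that])
    then show "k \<in> H"
      by (simp add: carrier_G m_assoc[symmetric])
  next
    assume "k \<in> H"
    with H that show "inv\<^bsub>G\<^esub> h \<otimes>\<^bsub>G\<^esub> k \<in> H"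
      by (intro subgroup.m_closed subgroup.m_inv_closed)
  qed
  have "truncate_op H \<in> commutant (left_reg G ` H)"
    unfolding commutant_def
    by (auto intro!: blinfun_eqI ell2_eqI simp: bounded_ops_def truncate_op.rep_eq truncate.rep_eq
        cscale.rep_eq ell2_fun_left_reg[OF G carrier_G] H_shift)
  with x have "x (truncate_op H (delta \<one>\<^bsub>G\<^esub>)) = truncate_op H (x (delta \<one>\<^bsub>G\<^esub>))"
    unfolding group_vN_def by (intro commutant_apply)
  moreover have "truncate_op H (delta \<one>\<^bsub>G\<^esub>) = delta \<one>\<^bsub>G\<^esub>"
    using subgroup.one_closed[OF H]
    by (intro ell2_eqI) (auto simp: truncate_op.rep_eq truncate.rep_eq delta.rep_eq)
  ultimately show ?thesis
    using g by (metis truncate.rep_eq truncate_op.rep_eq)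
qed

text \<open>If \<open>R\<close> is right multiplication by \<open>u\<^sup>*\<close>, then \<open>u R\<close> maps the vector \<open>x \<delta>\<^sub>e\<close> of \<open>x \<in> L(H)\<close> to the
  vector of \<open>u x u\<^sup>*\<close>. The last hypothesis says that the conditional expectation onto \<open>L(H)\<close> maps
  \<open>u x u\<^sup>*\<close> to \<open>t x + (1 - t) \<tau>(x)\<close>. This is a convex combination of contractions when \<open>0 \<le> t \<le> 1\<close>,
  so it is the point of the unit ball of \<open>L(H)\<close> closest to \<open>u x u\<^sup>*\<close>, at squared distance
  \<open>(1 - t\<^sup>2) (\<parallel>x\<parallel>\<^sup>2 - \<bar>\<tau>(x)\<bar>\<^sup>2)\<close>. Translations by non-trivial elements of \<open>H\<close> maximise the latter.\<close>

lemma d_MT_conj_by: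
  assumes H: "subgroup H G" and a: "a \<in> H" "a \<noteq> \<one>\<^bsub>G\<^esub>"
    and u: "unitary_op u"
    and R: "R \<in> commutant (left_reg G ` H)" "\<And>x. norm (blinfun_apply R x) = norm x"
      "R (delta \<one>\<^bsub>G\<^esub>) = adj u (delta \<one>\<^bsub>G\<^esub>)"
    and t: "0 \<le> t" "t \<le> 1"
    and W: "\<And>\<zeta> h. (\<And>k. k \<notin> H \<Longrightarrow> ell2_fun \<zeta> k = 0) \<Longrightarrow> h \<in> H \<Longrightarrow>
      ell2_fun (u (R \<zeta>)) h =
        of_real t * ell2_fun \<zeta> h + (if h = \<one>\<^bsub>G\<^esub> then of_real (1 - t) * ell2_fun \<zeta> h else 0)"
  shows "d_MT G (group_vN G H) (conj_by u (group_vN G H)) = sqrt (1 - t\<^sup>2)"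
proof -
  let ?e = "delta \<one>\<^bsub>G\<^esub> :: 'g ell2"
  define A where "A = unit_ball (group_vN G H)"
  define vec where "vec x = blinfun_apply x ?e" for x :: "'g ell2 \<Rightarrow>\<^sub>L 'g ell2"
  define expect where "expect \<xi> = t *\<^sub>R \<xi> + (1 - t) *\<^sub>R cscale (ell2_fun \<xi> \<one>\<^bsub>G\<^esub>) ?e"
    for \<xi> :: "'g ell2"
  define spread where "spread \<xi> = (1 - t\<^sup>2) * ((norm \<xi>)\<^sup>2 - (cmod (ell2_fun \<xi> \<one>\<^bsub>G\<^esub>))\<^sup>2)"
    for \<xi> :: "'g ell2"
  define D where "D x z = norm (vec x - u (R (vec z)))" for x z
  have A: "x \<in> group_vN G H" "norm x \<le> 1" "x \<in> bounded_ops" if "x \<in> A" for x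
    using that commutant_bounded_ops[of x] by (auto simp: A_def unit_ball_def group_vN_def)
  have supp: "ell2_fun (vec x) k = 0" if "x \<in> A" "k \<notin> H" for x k
    using group_vN_support[OF H A(1)[OF that(1)] that(2)] by (simp add: vec_def)
  have coeff: "\<xi> \<bullet> cscale c ?e = ell2_fun \<xi> \<one>\<^bsub>G\<^esub> \<bullet> c" for \<xi> c
    by (rule inner_delta)
  have u_bounded: "u \<in> bounded_ops" "adj u \<in> bounded_ops"
    using u adj_bounded_ops[of u] by (auto simp: unitary_op_def)
  have tr_norm_conj: "tr_norm G (x - (u o\<^sub>L z o\<^sub>L adj u)) = D x z" if "x \<in> A" "z \<in> A" for x z
  proof -
    have "x - (u o\<^sub>L z o\<^sub>L adj u) \<in> bounded_ops"
      using A that u_bounded by (intro bounded_ops_diff bounded_ops_compose)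
    moreover have "z (R ?e) = R (vec z)"
      using A(1)[OF that(2)] R(1) unfolding group_vN_def vec_def by (rule commutant_apply)
    ultimately show ?thesis
      by (simp add: tr_norm_eq D_def vec_def blinfun.diff_left R(3)[symmetric])
  qed
  have pairing: "vec x \<bullet> u (R (vec z)) = vec x \<bullet> expect (vec z)" if "x \<in> A" "z \<in> A" for x z
    unfolding inner_ell2.rep_eq
  proof (rule infsum_cong)
    fix h
    show "ell2_fun (vec x) h \<bullet> ell2_fun (u (R (vec z))) h
        = ell2_fun (vec x) h \<bullet> ell2_fun (expect (vec z)) h"
    proof (cases "h \<in> H")
      case True
      show ?thesis
        using W[of "vec z" h] supp[OF that(2)] True
        by (auto simp: expect_def plus_ell2.rep_eq scaleR_ell2.rep_eq cscale.rep_eq delta.rep_eq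
            scaleR_conv_of_real)
    qed (simp add: supp[OF that(1)])
  qed
  have inner_expect: "\<zeta> \<bullet> expect \<xi>
      = t * (\<zeta> \<bullet> \<xi>) + (1 - t) * (ell2_fun \<zeta> \<one>\<^bsub>G\<^esub> \<bullet> ell2_fun \<xi> \<one>\<^bsub>G\<^esub>)" for \<zeta> \<xi>
    by (simp add: expect_def inner_add_right coeff)
  have norm_expect: "expect \<xi> \<bullet> expect \<xi>
      = t\<^sup>2 * (\<xi> \<bullet> \<xi>) + (1 - t\<^sup>2) * (ell2_fun \<xi> \<one>\<^bsub>G\<^esub> \<bullet> ell2_fun \<xi> \<one>\<^bsub>G\<^esub>)" for \<xi>
  proof -
    have "ell2_fun (expect \<xi>) \<one>\<^bsub>G\<^esub> = ell2_fun \<xi> \<one>\<^bsub>G\<^esub>"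
      by (simp add: expect_def plus_ell2.rep_eq scaleR_ell2.rep_eq cscale.rep_eq delta.rep_eq
          scaleR_left_distrib[symmetric])
    then show ?thesis
      by (simp add: inner_expect inner_commute[of "expect \<xi>" \<xi>] algebra_simps power2_eq_square)
  qed
  have D_sq_sym: "(D x z)\<^sup>2 = (norm (vec x))\<^sup>2 + (norm (vec z))\<^sup>2 - 2 * (vec x \<bullet> expect (vec z))"
    if "x \<in> A" "z \<in> A" for x z
  proof -
    have "norm (u (R (vec z))) = norm (vec z)"
      by (simp add: unitary_op_isometry[OF u] R(2))
    then have "u (R (vec z)) \<bullet> u (R (vec z)) = vec z \<bullet> vec z"
      by (simp add: norm_eq_sqrt_inner)
    then show ?thesis
      by (simp add: D_def power2_norm_eq_inner inner_diff inner_commute[of "u _" "vec x"] pairing that)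
  qed
  \<comment> \<open>Conjugation by \<open>u\<^sup>*\<close> has the same conditional expectation, so both one-sided distances
    agree.\<close>
  have D_sym: "D x z = D z x" if "x \<in> A" "z \<in> A" for x z
  proof -
    have "(D x z)\<^sup>2 = (D z x)\<^sup>2"
      using that by (simp add: D_sq_sym inner_expect inner_commute)
    then show ?thesis by (simp add: D_def)
  qed
  have D_sq: "(D x z)\<^sup>2 = spread (vec x) + (norm (vec z - expect (vec x)))\<^sup>2"
    if "x \<in> A" "z \<in> A" for x z
    unfolding D_sym[OF that] D_sq_sym[OF that(2,1)] spread_def
    by (simp add: power2_norm_eq_inner inner_diff inner_commute[of "expect _" "vec z"] norm_expect
        algebra_simps)
  have vec_le: "norm (vec x) \<le> 1" if "x \<in> A" for x
    using norm_blinfun[of x ?e] A(2)[OF that] by (simp add: vec_def norm_delta)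
  have lower: "sqrt (spread (vec x)) \<le> D x z" if "x \<in> A" "z \<in> A" for x z
    using D_sq[OF that] by (intro real_le_lsqrt) (auto simp: D_def)
  have attained: "\<exists>z\<in>A. D x z = sqrt (spread (vec x))" if "x \<in> A" for x
  proof
    define c where "c = ell2_fun (vec x) \<one>\<^bsub>G\<^esub>"
    define z where "z = t *\<^sub>R x + (1 - t) *\<^sub>R scalar_op c"
    have "cmod c \<le> 1"
      using cmod_ell2_fun_le_norm vec_le[OF that] unfolding c_def by (rule order_trans)
    then have "norm (scalar_op c :: 'g ell2 \<Rightarrow>\<^sub>L 'g ell2) \<le> 1"
      by (intro norm_blinfun_bound) (auto simp: scalar_op.rep_eq norm_cscale mult_left_le_one_le)
    then have "norm z \<le> t * 1 + (1 - t) * 1"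
      unfolding z_def using t A(2)[OF that]
      by (intro norm_triangle_le add_mono) (simp_all add: mult_left_le)
    moreover have "z \<in> group_vN G H"
      using A(1)[OF that] unfolding z_def group_vN_def
      by (intro commutant_lincomb scalar_op_commutant) (auto simp: commutant_bounded_ops)
    ultimately show "z \<in> A" by (simp add: A_def unit_ball_def)
    have "vec z = expect (vec x)"
      by (simp add: vec_def z_def expect_def c_def blinfun.add_left blinfun.scaleR_left
          scalar_op.rep_eq)
    then have "(D x z)\<^sup>2 = spread (vec x)"
      using D_sq[OF that \<open>z \<in> A\<close>] by simp
    then show "D x z = sqrt (spread (vec x))"
      by (metis D_def norm_ge_zero real_sqrt_unique)
  qed
  have upper: "sqrt (spread (vec x)) \<le> sqrt (1 - t\<^sup>2)" if "x \<in> A" for x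
  proof -
    have "(norm (vec x))\<^sup>2 \<le> 1"
      using vec_le[OF that] by (simp add: power_le_one)
    then have "(norm (vec x))\<^sup>2 - (cmod (ell2_fun (vec x) \<one>\<^bsub>G\<^esub>))\<^sup>2 \<le> 1"
      by (smt (verit) zero_le_power2)
    then show ?thesis
      using t by (simp add: spread_def mult_left_le power_le_one)
  qed
  have "left_reg G a \<in> A"
  proof -
    have "left_reg G ` H \<subseteq> bounded_ops"
      using left_reg_bounded_ops[OF G carrier_G] by auto
    then have "left_reg G a \<in> group_vN G H"
      using subset_bicommutant a(1) unfolding group_vN_def by blast
    moreover have "norm (left_reg G a) \<le> 1"
      unfolding left_reg_eq_perm_op
      by (rule norm_isometry_le) (rule perm_op_isometry[OF bij_left_mult[OF G carrier_G]])
    ultimately show ?thesis by (simp add: A_def unit_ball_def)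
  qed
  moreover have "sqrt (spread (vec (left_reg G a))) = sqrt (1 - t\<^sup>2)"
    using a(2) by (simp add: vec_def left_reg_delta spread_def norm_delta delta.rep_eq)
  ultimately have "(SUP x\<in>A. INF z\<in>A. D x z) = sqrt (1 - t\<^sup>2)"
    using lower attained upper
    by (intro SUP_INF_attained[where m = "\<lambda>x. sqrt (spread (vec x))"])
  moreover have "(SUP z\<in>A. INF x\<in>A. D x z) = (SUP x\<in>A. INF z\<in>A. D x z)"
    using D_sym by (intro SUP_cong INF_cong) auto
  moreover have "(SUP x\<in>A. INF z\<in>A. tr_norm G (x - (u o\<^sub>L z o\<^sub>L adj u)))
      = (SUP x\<in>A. INF z\<in>A. D x z)"
    by (intro SUP_cong INF_cong refl tr_norm_conj)
  moreover have "(SUP z\<in>A. INF x\<in>A. tr_norm G (x - (u o\<^sub>L z o\<^sub>L adj u)))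
      = (SUP z\<in>A. INF x\<in>A. D x z)"
    by (intro SUP_cong INF_cong refl tr_norm_conj)
  ultimately show ?thesis
    unfolding d_MT_def hausdorff_distance_def unit_ball_conj_by[OF u] A_def[symmetric] image_image
    by simp
qed

end

section \<open>Conjugation by a Blaschke factor of a group element\<close>

context
  fixes G :: "('g, 'm) monoid_scheme"
  assumes G: "group G" and carrier_G: "carrier G = UNIV"
begin

interpretation group G by (rule G)

text \<open>Write \<open>c\<^sub>0 + c\<^sub>1 z + c\<^sub>2 z\<^sup>2 + \<dots>\<close> for the power series of the Blaschke factor, so \<open>c\<^sub>0 = - \<alpha>\<close>.
  For \<open>u = \<Sum>\<^sub>i c\<^sub>i \<lambda>\<^bsub>b\<^esub>\<^sup>i\<close> and \<open>x \<in> L(H)\<close> with vanishing trace, \<open>u x u\<^sup>*\<close> is a combination of the elements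
  \<open>h = b\<^sup>i k b\<^sup>-\<^sup>j\<close> with \<open>k \<noteq> e\<close> in \<open>H\<close>. Since \<open>b\<^sup>-\<^sup>i h b\<^sup>j = k\<close>, the hypothesis \<open>free\<close> says that \<open>h\<close>
  lies in \<open>H\<close> only if \<open>i = j = 0\<close>, and so \<open>u x u\<^sup>*\<close> projects to \<open>c\<^sub>0\<^sup>2 x = \<alpha>\<^sup>2 x\<close>.\<close>

lemma d_MT_conj_by_blaschke:
  assumes H: "subgroup H G" and a: "a \<in> H" "a \<noteq> \<one>\<^bsub>G\<^esub>"
    and free: "\<And>h i j. h \<in> H \<Longrightarrow> inv\<^bsub>G\<^esub> b [^]\<^bsub>G\<^esub> (i::nat) \<otimes>\<^bsub>G\<^esub> h \<otimes>\<^bsub>G\<^esub> b [^]\<^bsub>G\<^esub> (j::nat) \<in> H \<Longrightarrow>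
      inv\<^bsub>G\<^esub> b [^]\<^bsub>G\<^esub> i \<otimes>\<^bsub>G\<^esub> h \<otimes>\<^bsub>G\<^esub> b [^]\<^bsub>G\<^esub> j \<noteq> \<one>\<^bsub>G\<^esub> \<Longrightarrow> i = 0 \<and> j = 0"
    and \<alpha>: "0 \<le> \<alpha>" "\<alpha> < 1"
  shows "\<exists>u \<in> group_vN G (carrier G). unitary_op u \<and>
    d_MT G (group_vN G H) (conj_by u (group_vN G H)) = sqrt (1 - (\<alpha>\<^sup>2)\<^sup>2)"
proof -
  define p where "p h = inv\<^bsub>G\<^esub> b \<otimes>\<^bsub>G\<^esub> h" for h
  define p' where "p' h = b \<otimes>\<^bsub>G\<^esub> h" for h
  define q where "q h = h \<otimes>\<^bsub>G\<^esub> b" for h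
  have bij: "bij p" "bij p'" "bij q"
    unfolding p_def p'_def q_def
    by (rule bij_left_mult[OF G carrier_G] bij_right_mult[OF G carrier_G])+
  have pow_left: "((\<lambda>h. g \<otimes>\<^bsub>G\<^esub> h) ^^ n) h = g [^]\<^bsub>G\<^esub> n \<otimes>\<^bsub>G\<^esub> h" for g h and n :: nat
  proof (induction n)
    case (Suc n)
    then show ?case
      by (subst nat_pow_Suc2) (simp_all add: carrier_G m_assoc)
  qed (simp add: carrier_G)
  have pow_right: "((\<lambda>h. h \<otimes>\<^bsub>G\<^esub> g) ^^ n) h = h \<otimes>\<^bsub>G\<^esub> g [^]\<^bsub>G\<^esub> n" for g h and n :: nat
    by (induction n) (simp_all add: carrier_G m_assoc)
  have pow: "(p ^^ n) h = inv\<^bsub>G\<^esub> b [^]\<^bsub>G\<^esub> n \<otimes>\<^bsub>G\<^esub> h" "(p' ^^ n) h = b [^]\<^bsub>G\<^esub> n \<otimes>\<^bsub>G\<^esub> h"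
    "(q ^^ n) h = h \<otimes>\<^bsub>G\<^esub> b [^]\<^bsub>G\<^esub> n" for n h
    unfolding p_def p'_def q_def by (rule pow_left pow_right)+
  define u where "u = blaschke \<alpha> (perm_op p)"
  define u' where "u' = blaschke \<alpha> (perm_op p')"
  define R where "R = blaschke \<alpha> (perm_op q)"
  have \<alpha>': "\<bar>\<alpha>\<bar> < 1" using \<alpha> by simp
  note iso = bij[THEN perm_op_isometry]
  note le1 = iso[THEN norm_isometry_le]
  have inv: "perm_op p o\<^sub>L perm_op p' = id_blinfun" "perm_op p' o\<^sub>L perm_op p = id_blinfun"
    by (auto intro!: blinfun_eqI ell2_eqI
        simp: ell2_fun_perm_op[OF bij(1)] ell2_fun_perm_op[OF bij(2)] p_def p'_def carrier_G
          m_assoc[symmetric])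
  have adj_u: "adj u = u'"
    unfolding u_def u'_def by (intro adj_blaschke \<alpha>' iso perm_op_bounded_ops bij inv)
  have u_bounded: "u \<in> bounded_ops"
    unfolding u_def by (intro blaschke_bounded_ops \<alpha>' le1 perm_op_bounded_ops bij)
  have u: "unitary_op u"
    unfolding unitary_op_def adj_u using u_bounded
    by (auto simp: u_def u'_def blaschke_inverse[OF \<alpha>'] le1 inv)
  have u_in: "u \<in> group_vN G (carrier G)"
    unfolding group_vN_def commutant_def[of "commutant _"]
  proof (intro CollectI conjI ballI u_bounded)
    fix s assume s: "s \<in> commutant (left_reg G ` carrier G)"
    have "left_reg G b = perm_op p"
      unfolding left_reg_eq_perm_op[OF G carrier_G] p_def ..
    moreover have "s o\<^sub>L left_reg G b = left_reg G b o\<^sub>L s"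
      using s by (simp add: commutant_def carrier_G)
    ultimately have "s o\<^sub>L perm_op p = perm_op p o\<^sub>L s"
      by simp
    then show "u o\<^sub>L s = s o\<^sub>L u"
      unfolding u_def by (rule blaschke_commute[OF \<alpha>' le1(1), symmetric])
  qed
  have R_comm: "R \<in> commutant (left_reg G ` H)"
    unfolding commutant_def
  proof (intro CollectI conjI ballI)
    show "R \<in> bounded_ops"
      unfolding R_def by (intro blaschke_bounded_ops \<alpha>' le1 perm_op_bounded_ops bij)
    fix s assume "s \<in> left_reg G ` H"
    then obtain h where s: "s = left_reg G h" by blast
    have "s o\<^sub>L perm_op q = perm_op q o\<^sub>L s"
      by (intro blinfun_eqI ell2_eqI)
        (simp add: s ell2_fun_perm_op[OF bij(3)] ell2_fun_left_reg[OF G carrier_G] q_def carrier_G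
          m_assoc)
    then show "R o\<^sub>L s = s o\<^sub>L R"
      unfolding R_def by (rule blaschke_commute[OF \<alpha>' le1(3), symmetric])
  qed
  have R_isometry: "norm (R x) = norm x" for x
    unfolding R_def norm_eq_sqrt_inner by (simp add: blaschke_isometry[OF \<alpha>' iso(3)])
  let ?e = "delta \<one>\<^bsub>G\<^esub> :: 'g ell2"
  have R_delta: "R ?e = adj u ?e"
  proof (rule ell2_eqI)
    fix h
    have "h \<otimes>\<^bsub>G\<^esub> k = \<one>\<^bsub>G\<^esub> \<longleftrightarrow> k \<otimes>\<^bsub>G\<^esub> h = \<one>\<^bsub>G\<^esub>" for k
      using inv_comm[of h k] inv_comm[of k h] by (auto simp: carrier_G)
    then show "ell2_fun (R ?e) h = ell2_fun (adj u ?e) h"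
      unfolding adj_u u'_def R_def
      by (simp add: ell2_fun_blaschke_perm_op[OF bij(2) \<alpha>'] ell2_fun_blaschke_perm_op[OF bij(3) \<alpha>']
          pow delta.rep_eq del: funpow.simps)
  qed
  have u_delta: "u (R ?e) = ?e"
    using u unfolding R_delta unitary_op_def
    by (metis blinfun_apply_blinfun_compose blinfun_apply_id_blinfun)
  have traceless: "ell2_fun (u (R \<xi>)) h = of_real (\<alpha>\<^sup>2) * ell2_fun \<xi> h"
    if \<xi>: "\<And>k. k \<notin> H \<or> k = \<one>\<^bsub>G\<^esub> \<Longrightarrow> ell2_fun \<xi> k = 0" and h: "h \<in> H" for \<xi> h
  proof -
    have vanish: "ell2_fun \<xi> ((q ^^ j) ((p ^^ i) h)) = 0" if "i \<noteq> 0 \<or> j \<noteq> 0" for i j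
      using free[OF h, of i j] that \<xi>[of "(q ^^ j) ((p ^^ i) h)"] unfolding pow by blast
    have R_vanish: "ell2_fun (R \<xi>) ((p ^^ Suc i) h) = 0" for i
      using vanish[of "Suc i"] vanish[of "Suc i" 0]
      unfolding R_def ell2_fun_blaschke_perm_op[OF bij(3) \<alpha>'] by (simp del: funpow.simps(2))
    have "ell2_fun (R \<xi>) h = - of_real \<alpha> * ell2_fun \<xi> h"
      using vanish[of 0]
      unfolding R_def ell2_fun_blaschke_perm_op[OF bij(3) \<alpha>'] by (simp del: funpow.simps(2))
    then show ?thesis
      unfolding u_def ell2_fun_blaschke_perm_op[OF bij(1) \<alpha>'] R_vanish
      by (simp add: power2_eq_square)
  qed
  have "ell2_fun (u (R \<zeta>)) h = of_real (\<alpha>\<^sup>2) * ell2_fun \<zeta> h +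
      (if h = \<one>\<^bsub>G\<^esub> then of_real (1 - \<alpha>\<^sup>2) * ell2_fun \<zeta> h else 0)"
    if \<zeta>: "\<And>k. k \<notin> H \<Longrightarrow> ell2_fun \<zeta> k = 0" and h: "h \<in> H" for \<zeta> h
  proof -
    define c where "c = ell2_fun \<zeta> \<one>\<^bsub>G\<^esub>"
    define \<xi> where "\<xi> = \<zeta> - cscale c ?e"
    have \<xi>_fun: "ell2_fun \<xi> k = ell2_fun \<zeta> k - (if k = \<one>\<^bsub>G\<^esub> then c else 0)" for k
      by (simp add: \<xi>_def minus_ell2.rep_eq cscale.rep_eq delta.rep_eq)
    have fixed: "u (R (cscale c ?e)) = cscale c ?e"
      using u_bounded commutant_bounded_ops[OF R_comm] u_delta by (simp add: bounded_ops_def)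
    have "u (R \<zeta>) = u (R (\<xi> + cscale c ?e))"
      by (simp add: \<xi>_def)
    also have "\<dots> = u (R \<xi>) + cscale c ?e"
      by (simp only: blinfun.add_right fixed)
    finally have "u (R \<zeta>) = u (R \<xi>) + cscale c ?e" .
    moreover have "ell2_fun (u (R \<xi>)) h = of_real (\<alpha>\<^sup>2) * ell2_fun \<xi> h"
    proof (rule traceless[OF _ h])
      fix k assume "k \<notin> H \<or> k = \<one>\<^bsub>G\<^esub>"
      then show "ell2_fun \<xi> k = 0"
      proof
        assume "k \<notin> H"
        moreover from this have "k \<noteq> \<one>\<^bsub>G\<^esub>"
          using subgroup.one_closed[OF H] by blast
        ultimately show ?thesis
          by (simp add: \<xi>_fun \<zeta>)
      qed (simp add: \<xi>_fun c_def)
    qed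
    ultimately show ?thesis
      by (auto simp: \<xi>_fun plus_ell2.rep_eq cscale.rep_eq delta.rep_eq c_def algebra_simps)
  qed
  then have "d_MT G (group_vN G H) (conj_by u (group_vN G H)) = sqrt (1 - (\<alpha>\<^sup>2)\<^sup>2)"
    using \<alpha> by (intro d_MT_conj_by[OF G carrier_G H a u R_comm R_isometry R_delta])
      (auto simp: power_le_one)
  with u u_in show ?thesis by blast
qed

text \<open>As \<open>\<alpha>\<close> tends to 1 the Blaschke factor degenerates to the constant \<open>-1\<close>, which conjugates like
  the identity. The identity supplies this end of the family.\<close>

lemma d_MT_conj_by_id:
  assumes H: "subgroup H G" and a: "a \<in> H" "a \<noteq> \<one>\<^bsub>G\<^esub>"
  shows "\<exists>u \<in> group_vN G (carrier G). unitary_op u \<and>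
    d_MT G (group_vN G H) (conj_by u (group_vN G H)) = 0"
proof -
  have bounded: "id_blinfun \<in> bounded_ops"
    by (simp add: bounded_ops_def)
  then have adj: "adj id_blinfun = (id_blinfun :: 'g ell2 \<Rightarrow>\<^sub>L 'g ell2)"
    by (rule adj_eqI_inner) simp
  have "id_blinfun o\<^sub>L T = T o\<^sub>L id_blinfun" for T :: "'g ell2 \<Rightarrow>\<^sub>L 'g ell2"
    by (rule blinfun_eqI) simp
  with bounded have comm: "id_blinfun \<in> commutant S" for S :: "('g ell2 \<Rightarrow>\<^sub>L 'g ell2) set"
    by (simp add: commutant_def)
  have u: "unitary_op (id_blinfun :: 'g ell2 \<Rightarrow>\<^sub>L 'g ell2)"
    using bounded unfolding unitary_op_def adj by (auto intro!: blinfun_eqI)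
  have "d_MT G (group_vN G H) (conj_by id_blinfun (group_vN G H)) = sqrt (1 - 1\<^sup>2)"
    by (rule d_MT_conj_by[OF G carrier_G H a u comm]) (auto simp: adj)
  with u comm show ?thesis
    unfolding group_vN_def by auto
qed

end

section \<open>The free group of rank two\<close>

text \<open>The generators act on \<open>\<int>\<^sup>2\<close> by the transvections \<open>(x, y) \<mapsto> (x + y, y)\<close> and
  \<open>(x, y) \<mapsto> (x, y + x)\<close>. Computing with this action replaces normal forms of reduced words in the
  comparison of \<open>b\<^sup>-\<^sup>i a\<^sup>m b\<^sup>j\<close> with powers of \<open>a\<close>.\<close>

fun letter_action :: "gen2 \<times> bool \<Rightarrow> int \<times> int \<Rightarrow> int \<times> int" where
  "letter_action (gen_a, s) (x, y) = (if s then x + y else x - y, y)"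
| "letter_action (gen_b, s) (x, y) = (x, if s then y + x else y - x)"

lift_definition plane_action :: "gen2 free_group \<Rightarrow> int \<times> int \<Rightarrow> int \<times> int" is
  "foldr letter_action"
proof -
  have cancel: "letter_action (g, s) (letter_action (g, \<not> s) v) = v" for g s v
    by (cases g; cases v) auto
  fix w w' :: "(gen2 \<times> bool) list"
  assume "equivclp cancels w w'"
  then show "foldr letter_action w = foldr letter_action w'"
    by (induction rule: equivclp_induct) (auto elim!: cancels.cases simp: cancel fun_eq_iff)
qed

abbreviation (input) "\<a> \<equiv> fg_gen gen_a"
abbreviation (input) "\<b> \<equiv> fg_gen gen_b"

interpretation F2: group F2
  by (rule group_FreeGroup)

lemma plane_action_mult: "plane_action (g \<otimes>\<^bsub>F2\<^esub> h) v = plane_action g (plane_action h v)"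
  unfolding FreeGroup_def by simp (transfer, simp)

lemma plane_action_one: "plane_action \<one>\<^bsub>F2\<^esub> v = v"
  unfolding FreeGroup_def by simp (transfer, simp)

lemma plane_action_gen:
  "plane_action \<a> (x, y) = (x + y, y)" "plane_action \<b> (x, y) = (x, y + x)"
  by (transfer, simp)+

lemma plane_action_inv_eqI:
  assumes "plane_action g w = v"
  shows "plane_action (inv\<^bsub>F2\<^esub> g) v = w"
  by (simp add: assms[symmetric] plane_action_mult[symmetric] plane_action_one)

lemma plane_action_power_a:
  "plane_action (\<a> [^]\<^bsub>F2\<^esub> (m::int)) (x, y) = (x + m * y, y)"
proof -
  have nat: "plane_action (\<a> [^]\<^bsub>F2\<^esub> (n::nat)) (x, y) = (x + int n * y, y)" for n x
    by (induction n arbitrary: x)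
      (simp_all add: plane_action_mult plane_action_one plane_action_gen algebra_simps)
  show ?thesis
  proof (cases "m < 0")
    case True
    then have "plane_action (inv\<^bsub>F2\<^esub> (\<a> [^]\<^bsub>F2\<^esub> nat (- m))) (x, y) = (x + m * y, y)"
      by (intro plane_action_inv_eqI) (simp only: nat, simp)
    with True show ?thesis by (simp only: int_pow_def2 if_True)
  next
    case False
    then have "plane_action (\<a> [^]\<^bsub>F2\<^esub> nat m) (x, y) = (x + m * y, y)"
      by (simp only: nat, simp)
    with False show ?thesis by (simp only: int_pow_def2 if_False)
  qed
qed

lemma plane_action_power_b:
  "plane_action (\<b> [^]\<^bsub>F2\<^esub> (n::nat)) (x, y) = (x, y + int n * x)"
  by (induction n arbitrary: y)
    (simp_all add: plane_action_mult plane_action_one plane_action_gen algebra_simps)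

lemma plane_action_power_inv_b:
  "plane_action (inv\<^bsub>F2\<^esub> \<b> [^]\<^bsub>F2\<^esub> (n::nat)) (x, y) = (x, y - int n * x)"
  unfolding F2.nat_pow_inv[of \<b>, simplified]
  by (rule plane_action_inv_eqI) (simp add: plane_action_power_b)

text \<open>The power \<open>a\<^sup>m\<close> fixes \<open>(1, 0)\<close> and moves \<open>(0, 1)\<close> to \<open>(m, 1)\<close>. Comparing the images of these two
  vectors under both elements settles all exponents.\<close>

lemma conj_in_generate_a:
  assumes h: "h \<in> generate F2 {\<a>}"
    and g: "inv\<^bsub>F2\<^esub> \<b> [^]\<^bsub>F2\<^esub> (i::nat) \<otimes>\<^bsub>F2\<^esub> h \<otimes>\<^bsub>F2\<^esub> \<b> [^]\<^bsub>F2\<^esub> (j::nat) \<in> generate F2 {\<a>}"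
    and ne: "inv\<^bsub>F2\<^esub> \<b> [^]\<^bsub>F2\<^esub> i \<otimes>\<^bsub>F2\<^esub> h \<otimes>\<^bsub>F2\<^esub> \<b> [^]\<^bsub>F2\<^esub> j \<noteq> \<one>\<^bsub>F2\<^esub>"
  shows "i = 0 \<and> j = 0"
proof -
  obtain m n :: int where h_eq: "h = \<a> [^]\<^bsub>F2\<^esub> m"
    and g_eq: "inv\<^bsub>F2\<^esub> \<b> [^]\<^bsub>F2\<^esub> i \<otimes>\<^bsub>F2\<^esub> h \<otimes>\<^bsub>F2\<^esub> \<b> [^]\<^bsub>F2\<^esub> j = \<a> [^]\<^bsub>F2\<^esub> n"
    using h g F2.generate_pow[of \<a>] by auto
  have act: "plane_action (inv\<^bsub>F2\<^esub> \<b> [^]\<^bsub>F2\<^esub> i \<otimes>\<^bsub>F2\<^esub> h \<otimes>\<^bsub>F2\<^esub> \<b> [^]\<^bsub>F2\<^esub> j) (x, y)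
      = plane_action (\<a> [^]\<^bsub>F2\<^esub> n) (x, y)" for x y
    by (simp only: g_eq)
  have "n \<noteq> 0"
    using ne unfolding g_eq by (metis int_pow_0)
  moreover have "m = n"
    using act[of 0 1]
    by (simp add: h_eq plane_action_mult plane_action_power_a plane_action_power_b
        plane_action_power_inv_b)
  moreover have "m * int j = 0" "int j = int i * (1 + m * int j)"
    using act[of 1 0]
    by (simp_all add: h_eq plane_action_mult plane_action_power_a plane_action_power_b
        plane_action_power_inv_b)
  ultimately show ?thesis by auto
qed

theorem corollary5p18:
  fixes r :: real
  assumes "r \<in> {0..1}"
  shows "\<exists>u \<in> group_vN F2 (carrier F2). unitary_op u \<and>
    d_MT F2 (group_vN F2 (generate F2 {fg_gen gen_a}))
      (conj_by u (group_vN F2 (generate F2 {fg_gen gen_a}))) = r"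
proof -
  have H: "subgroup (generate F2 {\<a>}) F2"
    by (rule F2.generate_is_subgroup) simp
  have a: "\<a> \<in> generate F2 {\<a>}"
    by (rule generate.incl) simp
  have a_ne: "\<a> \<noteq> \<one>\<^bsub>F2\<^esub>"
    using plane_action_gen(1)[of 0 1] plane_action_one[of "(0, 1)"] by auto
  show ?thesis
  proof (cases "r = 0")
    case True
    then show ?thesis
      using d_MT_conj_by_id[OF group_FreeGroup carrier_FreeGroup H a a_ne] by simp
  next
    case False
    \<comment> \<open>Solves \<open>r\<^sup>2 = 1 - \<alpha>\<^sup>4\<close>; the case \<open>r = 0\<close> is the limit \<open>\<alpha> = 1\<close>, where the geometric series
      diverges.\<close>
    define \<alpha> where "\<alpha> = sqrt (sqrt (1 - r\<^sup>2))"
    have r: "0 < r" "r \<le> 1"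
      using assms False by auto
    then have "0 \<le> 1 - r\<^sup>2" "1 - r\<^sup>2 < 1"
      by (simp_all add: power_le_one)
    then have \<alpha>: "0 \<le> \<alpha>" "\<alpha> < 1" "(\<alpha>\<^sup>2)\<^sup>2 = 1 - r\<^sup>2"
      by (simp_all add: \<alpha>_def)
    then have "sqrt (1 - (\<alpha>\<^sup>2)\<^sup>2) = r"
      using r unfolding \<alpha>(3) by simp
    moreover have "\<exists>u \<in> group_vN F2 (carrier F2). unitary_op u \<and>
        d_MT F2 (group_vN F2 (generate F2 {\<a>})) (conj_by u (group_vN F2 (generate F2 {\<a>})))
          = sqrt (1 - (\<alpha>\<^sup>2)\<^sup>2)"
      by (rule d_MT_conj_by_blaschke[OF group_FreeGroup carrier_FreeGroup H a a_ne _ \<alpha>(1,2)])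
        (rule conj_in_generate_a)
    ultimately show ?thesis
      by (simp only:)
  qed
qed

end
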